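(* For every wtt-complete set $A$ there is a constant $c$ such that $ic(x:A) \geq C(x) - c$ for infinitely many $x \in A$.
   Context: $\mathbb{N}$ is identified with $\{0,1\}^*$ via the canonical (length-lexicographic) bijection, so sets may be viewed as subsets of either. A set $B$ is wtt-reducible (weak truth-table reducible) to $A$ if there are a Turing reduction $\Phi$ and a total recursive function $g$ such that for all $x$, $\chi_B(x) = \Phi^A(x)$ and every oracle query made in the computation of $\Phi^A(x)$ is less than $g(x)$. A set is wtt-complete if it is r.e. and every r.e. set is wtt-reducible to it. $\lambda$ is the empty string, $l(p)$ is the length of $p \in \{0,1\}^*$, $\chi_A$ is the characteristic function of $A$, and $\perp$ is a special symbol ("don't know"). A (possibly partial) function $f : \{0,1\}^* \to \{0,1,\perp\}$ is $A$-consistent if for all $x \in \mathrm{dom}(f)$, $f(x) = \chi_A(x)$ or $f(x) = \perp$. For a partial recursive mapping $V : \{0,1\}^* \times \{0,1\}^* \to \{0,1\}^* \cup \{\perp\}$, $x \in \{0,1\}^*$ and $A \subseteq \{0,1\}^*$, define - $C_V(x) = \min\{ l(p) : V(p,\lambda) = x\}$ (Kolmogorov complexity); - $ic_V(x:A) = \min\{ l(p) : z \mapsto V(p,z)$ is a total $A$-consistent function and $V(p,x) = \chi_A(x)\}$ (instance complexity); with value $\infty$ if no such $p$ exists. (The output values $0,1$ of $V$ are regarded as the one-letter strings $0,1$.) Fix an optimal partial recursive mapping $U : \{0,1\}^* \times \{0,1\}^* \to \{0,1\}^* \cup \{\perp\}$, i.e., one such that for every partial recursive mapping $V : \{0,1\}^*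 \times \{0,1\}^* \to \{0,1\}^* \cup \{\perp\}$ there is a constant $d$ with $C_U(x) \leq C_V(x) + d$ and $ic_U(x:A) \leq ic_V(x:A) + d$ for all $x, A$. Write $C(x) = C_U(x)$ and $ic(x:A) = ic_U(x:A)$. *)

theory Defs
  imports Main "HOL-Library.Nat_Bijection" "HOL-Library.Extended_Nat"
begin

text \<open>
  The length-lexicographic bijection between binary strings and natural numbers
  (\<open>False\<close> is the letter 0, \<open>True\<close> the letter 1): a string is read as a number in
  bijective base two, so that the empty string, 0, 1, 00, 01, \<dots> are mapped to
  0, 1, 2, 3, 4, \<dots>.
\<close>

primrec str_nat :: "bool list \<Rightarrow> nat" where
  "str_nat [] = 0"
| "str_nat (b # p) = (if b then 2 else 1) * 2 ^ length p + str_nat p"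

lemma str_nat_bounds: "2 ^ length p \<le> Suc (str_nat p) \<and> Suc (str_nat p) < 2 * 2 ^ length p"
  by (induction p) auto

lemma str_nat_mono_length:
  assumes "length p < length q"
  shows "str_nat p < str_nat q"
proof -
  have "(2::nat) * 2 ^ length p \<le> 2 ^ length q"
    using assms power_increasing[of "Suc (length p)" "length q" "2::nat"] by simp
  then show ?thesis
    using str_nat_bounds[of p] str_nat_bounds[of q] by linarith
qed

lemma str_nat_less_iff_lenlex: "str_nat p < str_nat q \<longleftrightarrow> (p, q) \<in> lenlex {(False, True)}"
proof (induction p arbitrary: q)
  case Nil
  then show ?case
    by (cases q) auto
next
  case (Cons a p)
  show ?case
  proof (cases q)
    case Nil
    then show ?thesis by simp
  next
    case (Cons b q')
    show ?thesis
    proof (cases "length p = length q'")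
      case True
      have "str_nat p < 2 ^ length q' + str_nat q'" "str_nat q' < 2 ^ length q' + str_nat p"
        using True str_nat_bounds[of p] str_nat_bounds[of q'] by auto
      then show ?thesis
        using Cons True Cons.IH[of q'] by (auto simp: Cons_lenlex_iff)
    next
      case False
      then consider "length p < length q'" | "length q' < length p" by linarith
      then show ?thesis
      proof cases
        case 1
        then show ?thesis
          using Cons str_nat_mono_length[of "a # p" q] by (simp add: Cons_lenlex_iff)
      next
        case 2
        then have "\<not> str_nat (a # p) < str_nat q"
          using Cons str_nat_mono_length[of q "a # p"] by simp
        then show ?thesis
          using Cons 2 lenlex_length[of "a # p" q] by fastforce
      qed
    qed
  qed
qed

lemma bij_str_nat: "bij str_nat"
proof (rule bijI)
  show "inj str_nat"
  proof (rule injI)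
    fix p q
    assume "str_nat p = str_nat q"
    then have "(p, q) \<notin> lenlex {(False, True)}" "(q, p) \<notin> lenlex {(False, True)}"
      by (auto simp flip: str_nat_less_iff_lenlex)
    moreover have "total (lenlex {(False, True)})"
      by (rule total_lenlex) (auto simp: total_on_def)
    ultimately show "p = q"
      by (auto simp: total_on_def)
  qed
  have step: "str_nat (p @ [b]) = 2 * str_nat p + (if b then 2 else 1)" for p b
    by (induction p) auto
  have "\<exists>p. str_nat p = n" for n
  proof (induction n rule: less_induct)
    case (less n)
    show ?case
    proof (cases "n = 0")
      case True
      then show ?thesis by (intro exI[of _ "[]"]) simp
    next
      case False
      then have "(n - 1) div 2 < n" by linarith
      then obtain p where p: "str_nat p = (n - 1) div 2"
        using less by blast
      have "str_nat (p @ [even n]) = n"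
        using False by (simp only: step p) (auto elim!: evenE oddE)
      then show ?thesis by blast
    qed
  qed
  then show "surj str_nat"
    by (metis surjI)
qed


text \<open>
  Partial recursive functions relative to an oracle, in the unary presentation in which
  several arguments are packed with the Cantor pairing \<^const>\<open>prod_encode\<close>: the least
  class that contains the basic functions and the oracle and is closed under pairing,
  composition, primitive recursion and minimization.  A syntax of programs is needed
  because the oracle queries made in a computation must be observable.
\<close>

datatype prog =
    Zero | Succ | Fst | Snd | Oracle
  | Pair prog prog
  | Comp prog prog
  | PrimRec prog prog
  | Mu prog

text \<open>
  \<open>run A e x y Q\<close>: with oracle \<open>A\<close>, the computation of \<open>e\<close> on input \<open>x\<close> halts with
  output \<open>y\<close>, and \<open>Q\<close> is the set of all oracle queries made in it.  In the rule for \<open>Mu\<close>,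
  \<open>n\<close> is the least zero and the values at all smaller arguments are defined and nonzero.
\<close>

inductive run :: "nat set \<Rightarrow> prog \<Rightarrow> nat \<Rightarrow> nat \<Rightarrow> nat set \<Rightarrow> bool" for A :: "nat set" where
  run_Zero: "run A Zero x 0 {}"
| run_Succ: "run A Succ x (Suc x) {}"
| run_Fst: "run A Fst x (fst (prod_decode x)) {}"
| run_Snd: "run A Snd x (snd (prod_decode x)) {}"
| run_Oracle: "run A Oracle x (if x \<in> A then 1 else 0) {x}"
| run_Pair: "run A e x y Q \<Longrightarrow> run A f x z R \<Longrightarrow>
    run A (Pair e f) x (prod_encode (y, z)) (Q \<union> R)"
| run_Comp: "run A f x y Q \<Longrightarrow> run A e y z R \<Longrightarrow> run A (Comp e f) x z (Q \<union> R)"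
| run_PrimRec_0: "run A e x y Q \<Longrightarrow> run A (PrimRec e f) (prod_encode (x, 0)) y Q"
| run_PrimRec_Suc: "run A (PrimRec e f) (prod_encode (x, n)) y Q \<Longrightarrow>
    run A f (prod_encode (x, prod_encode (n, y))) z R \<Longrightarrow>
    run A (PrimRec e f) (prod_encode (x, Suc n)) z (Q \<union> R)"
| run_Mu: "run A e (prod_encode (x, n)) 0 (Q n) \<Longrightarrow>
    (\<And>i. i < n \<Longrightarrow> run A e (prod_encode (x, i)) (Suc (v i)) (Q i)) \<Longrightarrow>
    run A (Mu e) x n (\<Union>i\<le>n. Q i)"

primrec oracle_free :: "prog \<Rightarrow> bool" where
  "oracle_free Zero \<longleftrightarrow> True"
| "oracle_free Succ \<longleftrightarrow> True"
| "oracle_free Fst \<longleftrightarrow> True"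
| "oracle_free Snd \<longleftrightarrow> True"
| "oracle_free Oracle \<longleftrightarrow> False"
| "oracle_free (Pair e f) \<longleftrightarrow> oracle_free e \<and> oracle_free f"
| "oracle_free (Comp e f) \<longleftrightarrow> oracle_free e \<and> oracle_free f"
| "oracle_free (PrimRec e f) \<longleftrightarrow> oracle_free e \<and> oracle_free f"
| "oracle_free (Mu e) \<longleftrightarrow> oracle_free e"

text \<open>The oracle \<open>{}\<close> below is a dummy, since the program never queries it.\<close>

definition partial_recursive :: "(nat \<Rightarrow> nat option) \<Rightarrow> bool" where
  "partial_recursive f \<longleftrightarrow>
     (\<exists>e. oracle_free e \<and> (\<forall>x y. f x = Some y \<longleftrightarrow> (\<exists>Q. run {} e x y Q)))"

definition total_recursive :: "(nat \<Rightarrow> nat) \<Rightarrow> bool" where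
  "total_recursive g \<longleftrightarrow> partial_recursive (\<lambda>x. Some (g x))"

definition re_set :: "nat set \<Rightarrow> bool" where
  "re_set B \<longleftrightarrow> (\<exists>f. partial_recursive f \<and> B = dom f)"

definition wtt_reducible :: "nat set \<Rightarrow> nat set \<Rightarrow> bool" where
  "wtt_reducible B A \<longleftrightarrow>
     (\<exists>e g. total_recursive g \<and>
        (\<forall>x. \<exists>Q. run A e x (if x \<in> B then 1 else 0) Q \<and> (\<forall>q\<in>Q. q < g x)))"

definition wtt_complete :: "nat set \<Rightarrow> bool" where
  "wtt_complete A \<longleftrightarrow> re_set A \<and> (\<forall>B. re_set B \<longrightarrow> wtt_reducible B A)"


text \<open>The set of binary strings extended by the symbol \<open>Bot\<close> (``don't know'').\<close>

datatype outcome = Str "bool list" | Bot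

primrec outcome_nat :: "outcome \<Rightarrow> nat" where
  "outcome_nat Bot = 0"
| "outcome_nat (Str w) = Suc (str_nat w)"

text \<open>
  For \<open>V :: bool list \<Rightarrow> bool list \<Rightarrow> outcome option\<close>, the value \<^const>\<open>None\<close> means that
  \<open>V\<close> is undefined, whereas \<open>Some Bot\<close> means that the computation halts with ``don't know''.
\<close>

definition partial_recursive_mapping :: "(bool list \<Rightarrow> bool list \<Rightarrow> outcome option) \<Rightarrow> bool" where
  "partial_recursive_mapping V \<longleftrightarrow>
     (\<exists>f. partial_recursive f \<and>
        (\<forall>p z. f (prod_encode (str_nat p, str_nat z)) = map_option outcome_nat (V p z)))"

text \<open>The truth values 0 and 1 are regarded as one-letter strings.\<close>

definition char_fun :: "bool list set \<Rightarrow> bool list \<Rightarrow> outcome" where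
  "char_fun A x = Str [x \<in> A]"

definition consistent :: "bool list set \<Rightarrow> (bool list \<Rightarrow> outcome option) \<Rightarrow> bool" where
  "consistent A f \<longleftrightarrow> (\<forall>x \<in> dom f. f x = Some (char_fun A x) \<or> f x = Some Bot)"

text \<open>In \<^typ>\<open>enat\<close>, the infimum of a nonempty set is its minimum, and that of the empty set is \<open>\<infinity>\<close>.\<close>

definition kolmogorov :: "(bool list \<Rightarrow> bool list \<Rightarrow> outcome option) \<Rightarrow> bool list \<Rightarrow> enat" where
  "kolmogorov V x = Inf {enat (length p) | p. V p [] = Some (Str x)}"

definition inst_complexity ::
    "(bool list \<Rightarrow> bool list \<Rightarrow> outcome option) \<Rightarrow> bool list \<Rightarrow> bool list set \<Rightarrow> enat" where
  "inst_complexity V x A =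
     Inf {enat (length p) | p.
       dom (V p) = UNIV \<and> consistent A (V p) \<and> V p x = Some (char_fun A x)}"

definition optimal :: "(bool list \<Rightarrow> bool list \<Rightarrow> outcome option) \<Rightarrow> bool" where
  "optimal U \<longleftrightarrow> partial_recursive_mapping U \<and>
     (\<forall>V. partial_recursive_mapping V \<longrightarrow>
        (\<exists>d::nat. \<forall>x A. kolmogorov U x \<le> kolmogorov V x + enat d \<and>
                        inst_complexity U x A \<le> inst_complexity V x A + enat d))"

end

theory Submission
  imports Defs
begin

text \<open>
  For every candidate reduction \<open>k\<close> with use bound \<open>g\<close> and every \<open>n\<close>, the r.e. set \<open>B\<close> to be
  reduced to \<open>X\<close> has witnesses \<open>b(k, n, i)\<close>, \<open>i \<le> 2^n\<close>; letting \<open>B\<close> range over all \<open>k\<close> makes the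
  recursion theorem unnecessary.  Let \<open>m\<close> bound \<open>g\<close> on the witnesses of a level.  The next witness is put into
  \<open>B\<close> only while the reduction, with oracle \<open>X\<^sub>d\<close> cut off at \<open>m\<close>, rejects it, so some \<open>x < m\<close>
  has to enter \<open>X\<close> after stage \<open>d\<close>.  Before the following witness is used, one waits until \<open>x\<close> is covered:
  some program of length less than \<open>n\<close> accepts \<open>x\<close> and is defined and agrees with the current approximation of \<open>X\<close>
  on all of \<open>{0..<m}\<close>.  The use bound is what makes this a finite condition.  The covering programs are pairwise
  distinct, so the level gets stuck at some \<open>x\<close> found for the \<open>i\<close>-th witness with \<open>i \<le> 2^n\<close>.  This \<open>x\<close> has
  instance complexity at least \<open>n\<close>, whereas a string of length \<open>n\<close> encodes both \<open>n\<close> and \<open>i\<close>, which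
  determine \<open>x\<close>.
\<close>

subsection \<open>Recursive functions and predicates\<close>

definition pr :: "nat \<Rightarrow> nat \<Rightarrow> nat" where "pr a b = prod_encode (a, b)"
definition p1 :: "nat \<Rightarrow> nat" where "p1 z = fst (prod_decode z)"
definition p2 :: "nat \<Rightarrow> nat" where "p2 z = snd (prod_decode z)"

lemma p1_pr [simp]: "p1 (pr a b) = a" and p2_pr [simp]: "p2 (pr a b) = b"
  and pr_p1_p2 [simp]: "pr (p1 z) (p2 z) = z"
  and pr_eq_iff [simp]: "pr a b = pr c d \<longleftrightarrow> a = c \<and> b = d"
  by (simp_all add: pr_def p1_def p2_def prod_encode_eq)

section \<open>Determinism of computations\<close>

inductive_cases run_PairE: "run A (Pair e f) x y Q"
inductive_cases run_CompE: "run A (Comp e f) x y Q"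
inductive_cases run_PrimRecE: "run A (PrimRec e f) x y Q"
inductive_cases run_MuE: "run A (Mu e) x y Q"
inductive_cases run_basicE:
  "run A Zero x y Q" "run A Succ x y Q" "run A Fst x y Q" "run A Snd x y Q" "run A Oracle x y Q"

lemma run_deterministic: "run A e x y Q \<Longrightarrow> run A e x y' Q' \<Longrightarrow> y = y'"
proof (induction arbitrary: y' Q' rule: run.induct)
  case (run_Pair e x y Q f z R)
  from run_Pair.prems obtain y1 z1 Q1 R1
    where "y' = prod_encode (y1, z1)" "run A e x y1 Q1" "run A f x z1 R1"
    by (rule run_PairE)
  then show ?case using run_Pair.IH by metis
next
  case (run_Comp f x y Q e z R)
  from run_Comp.prems obtain y1 Q1 R1 where "run A f x y1 Q1" "run A e y1 y' R1"
    by (rule run_CompE)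
  then show ?case using run_Comp.IH by metis
next
  case (run_PrimRec_0 e x y Q f)
  from run_PrimRec_0.prems show ?case
    by (cases rule: run_PrimRecE) (use run_PrimRec_0.IH in \<open>auto simp: prod_encode_eq\<close>)
next
  case (run_PrimRec_Suc e f x n y Q z R)
  from run_PrimRec_Suc.prems obtain y1 Q1 R1
    where "run A (PrimRec e f) (prod_encode (x, n)) y1 Q1"
      "run A f (prod_encode (x, prod_encode (n, y1))) y' R1"
    by (rule run_PrimRecE) (auto simp: prod_encode_eq)
  then show ?case using run_PrimRec_Suc.IH by metis
next
  case (run_Mu e x n Q v)
  from run_Mu.prems obtain Q2 v2 where 2: "run A e (prod_encode (x, y')) 0 (Q2 y')"
    "\<And>i. i < y' \<Longrightarrow> run A e (prod_encode (x, i)) (Suc (v2 i)) (Q2 i)"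
    by (rule run_MuE) auto
  \<comment> \<open>Each run yields nonzero values below its own zero, so neither zero can lie below
    the other.\<close>
  have "\<not> n < y'" using run_Mu.IH(1)[OF 2(2)[of n]] by auto
  moreover have "\<not> y' < n" using run_Mu.IH(2)[OF _ 2(1)] by auto
  ultimately show ?case by simp
qed (blast elim: run_basicE)+

text \<open>Only a halting run with the right value is required; uniqueness of the output comes from
  \<open>run_deterministic\<close>. The closure rules below follow the syntax of the body under
  \<open>\<lambda>z\<close>, so recursiveness of a concrete function is proved by repeated
  introduction.\<close>

definition recf :: "(nat \<Rightarrow> nat) \<Rightarrow> bool" where
  "recf f \<longleftrightarrow> (\<exists>e. oracle_free e \<and> (\<forall>x. \<exists>Q. run {} e x (f x) Q))"

definition recp :: "(nat \<Rightarrow> bool) \<Rightarrow> bool" where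
  "recp P \<longleftrightarrow> recf (\<lambda>z. if P z then 1 else 0)"

section \<open>Closure properties of total recursive functions and decidable predicates\<close>

lemma recf_comp:
  assumes "recf F" "recf f"
  shows "recf (\<lambda>z. F (f z))"
proof -
  from assms obtain e1 e2 where "oracle_free e1" "\<forall>x. \<exists>Q. run {} e1 x (F x) Q"
    "oracle_free e2" "\<forall>x. \<exists>Q. run {} e2 x (f x) Q"
    unfolding recf_def by blast
  then show ?thesis
    unfolding recf_def by (intro exI[of _ "Comp e1 e2"]) (auto, meson run_Comp)
qed

lemma recf_pr:
  assumes "recf f" "recf g"
  shows "recf (\<lambda>z. pr (f z) (g z))"
proof -
  from assms obtain e1 e2 where "oracle_free e1" "\<forall>x. \<exists>Q. run {} e1 x (f x) Q"
    "oracle_free e2" "\<forall>x. \<exists>Q. run {} e2 x (g x) Q"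
    unfolding recf_def by blast
  then show ?thesis
    unfolding recf_def pr_def by (intro exI[of _ "Pair e1 e2"]) (auto, meson run_Pair)
qed

lemma recf_p1_basic: "recf p1"
  unfolding recf_def p1_def by (intro exI[of _ Fst]) (auto intro: run_Fst)

lemma recf_p2_basic: "recf p2"
  unfolding recf_def p2_def by (intro exI[of _ Snd]) (auto intro: run_Snd)

lemma recf_Suc_basic: "recf Suc"
  unfolding recf_def by (intro exI[of _ Succ]) (auto intro: run_Succ)

lemmas recf_p1 = recf_comp[OF recf_p1_basic]
lemmas recf_p2 = recf_comp[OF recf_p2_basic]
lemmas recf_Suc = recf_comp[OF recf_Suc_basic]

lemma recf_id: "recf (\<lambda>z. z)"
  using recf_pr[OF recf_p1_basic recf_p2_basic] by simp

lemma recf_const: "recf (\<lambda>z. c)"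
proof (induction c)
  case 0
  show ?case unfolding recf_def by (intro exI[of _ Zero]) (auto intro: run_Zero)
next
  case (Suc c)
  then show ?case by (rule recf_Suc)
qed

lemma recf_rec_nat:
  assumes "recf (\<lambda>w. h (p1 w) (p1 (p2 w)) (p2 (p2 w)))" "recf b" "recf g"
  shows "recf (\<lambda>z. rec_nat (b z) (\<lambda>n y. h z n y) (g z))"
proof -
  from assms obtain e1 e2 where e: "oracle_free e1" "\<And>x. \<exists>Q. run {} e1 x (b x) Q"
    "oracle_free e2" "\<And>w. \<exists>Q. run {} e2 w (h (p1 w) (p1 (p2 w)) (p2 (p2 w))) Q"
    unfolding recf_def by blast
  have "\<exists>Q. run {} (PrimRec e1 e2) (prod_encode (x, n)) (rec_nat (b x) (h x) n) Q" for x n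
  proof (induction n)
    case 0
    then show ?case using e(2)[of x] by (auto intro: run_PrimRec_0)
  next
    case (Suc n)
    then show ?case
      using e(4)[of "pr x (pr n (rec_nat (b x) (h x) n))"]
      by (fastforce simp: pr_def p1_def p2_def intro: run_PrimRec_Suc)
  qed
  then have "recf (\<lambda>w. rec_nat (b (p1 w)) (h (p1 w)) (p2 w))"
    unfolding recf_def using e(1,3)
    by (intro exI[of _ "PrimRec e1 e2"]) (metis oracle_free.simps(8) pr_def pr_p1_p2)
  \<comment> \<open>\<open>PrimRec\<close> hands its parameter on unchanged; pairing the whole input
    \<open>z\<close> with the number of iterations \<open>g z\<close> makes \<open>z\<close>
    available to both \<open>b\<close> and \<open>h\<close>.\<close>
  from recf_comp[OF this recf_pr[OF recf_id assms(3)]] show ?thesis by simp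
qed

lemmas recf_basic = recf_p1 recf_p2 recf_Suc recf_id recf_const recf_pr

lemma recf_if:
  assumes "recp P" "recf f" "recf g"
  shows "recf (\<lambda>z. if P z then f z else g z)"
proof -
  \<comment> \<open>A case distinction is a recursion of length 0 or 1 that starts with the
    else-branch.\<close>
  have "recf (\<lambda>z. rec_nat (g z) (\<lambda>n y. f z) (if P z then 1 else 0))"
    by (rule recf_rec_nat) (intro assms recf_comp[OF assms(2)] assms[unfolded recp_def] recf_basic)+
  then show ?thesis
    by (rule back_subst[where P = recf]) auto
qed

lemma recf_pred: "recf f \<Longrightarrow> recf (\<lambda>z. f z - 1)"
proof -
  assume f: "recf f"
  have "recf (\<lambda>z. rec_nat 0 (\<lambda>n y. n) (f z))"
    by (intro recf_rec_nat recf_basic f)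
  moreover have "rec_nat 0 (\<lambda>n y. n) m = m - 1" for m :: nat by (cases m) auto
  ultimately show ?thesis by simp
qed

lemma recf_diff:
  assumes "recf f" "recf g"
  shows "recf (\<lambda>z. f z - g z)"
proof -
  have "recf (\<lambda>z. rec_nat (f z) (\<lambda>n y. y - 1) (g z))"
    by (intro recf_rec_nat recf_basic recf_pred assms)
  moreover have "rec_nat a (\<lambda>n y. y - 1) m = a - m" for a m :: nat by (induction m) auto
  ultimately show ?thesis by simp
qed

lemma recf_add:
  assumes "recf f" "recf g"
  shows "recf (\<lambda>z. f z + g z)"
proof -
  have "recf (\<lambda>z. rec_nat (f z) (\<lambda>n y. Suc y) (g z))"
    by (intro recf_rec_nat recf_basic assms)
  moreover have "rec_nat a (\<lambda>n y. Suc y) m = a + m" for a m :: nat by (induction m) auto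
  ultimately show ?thesis by simp
qed

lemma recf_pow2:
  assumes "recf f"
  shows "recf (\<lambda>z. 2 ^ f z)"
proof -
  have "recf (\<lambda>z. rec_nat 1 (\<lambda>n y. y + y) (f z))"
    by (intro recf_rec_nat recf_basic recf_add assms)
  moreover have "rec_nat (1::nat) (\<lambda>n y. y + y) m = 2 ^ m" for m by (induction m) auto
  ultimately show ?thesis by simp
qed

lemma recf_sum:
  assumes "recf (\<lambda>w. h (p1 w) (p2 w))" "recf f"
  shows "recf (\<lambda>z. \<Sum>j<f z. h z j)"
proof -
  have "recf (\<lambda>w. h (p1 w) (p1 (p2 w)))"
    using recf_comp[OF assms(1) recf_pr[OF recf_p1_basic recf_p1[OF recf_p2_basic]]] by simp
  then have "recf (\<lambda>z. rec_nat 0 (\<lambda>n y. y + h z n) (f z))"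
    by (intro recf_rec_nat recf_basic recf_add assms)
  moreover have "rec_nat 0 (\<lambda>n y. y + h z n) m = (\<Sum>j<m. h z j)" for z m
    by (induction m) auto
  ultimately show ?thesis by simp
qed

lemma recp_not: "recp P \<Longrightarrow> recp (\<lambda>z. \<not> P z)"
  using recf_if[of P "\<lambda>_. 0" "\<lambda>_. 1"] by (simp add: recp_def recf_const if_distrib cong: if_cong)
    (erule back_subst[where P = recf], auto)

lemma recp_eq_0: "recf f \<Longrightarrow> recp (\<lambda>z. f z = 0)"
proof -
  assume "recf f"
  then have "recf (\<lambda>z. 1 - f z)" by (intro recf_diff recf_const)
  then show ?thesis unfolding recp_def by (rule back_subst[where P = recf]) auto
qed

lemma recp_le:
  assumes "recf f" "recf g" shows "recp (\<lambda>z. f z \<le> g z)"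
  using recp_eq_0[OF recf_diff[OF assms]] by simp

lemma recp_less:
  assumes "recf f" "recf g" shows "recp (\<lambda>z. f z < g z)"
  using recp_not[OF recp_le[OF assms(2,1)]] by (simp add: not_le)

lemma recp_conj:
  assumes "recp P" "recp Q" shows "recp (\<lambda>z. P z \<and> Q z)"
proof -
  have "recf (\<lambda>z. if P z then if Q z then 1 else 0 else 0)"
    by (intro recf_if assms recf_const)
  then show ?thesis unfolding recp_def by (rule back_subst[where P = recf]) auto
qed

lemma recp_disj:
  assumes "recp P" "recp Q" shows "recp (\<lambda>z. P z \<or> Q z)"
proof -
  have "recp (\<lambda>z. \<not> (\<not> P z \<and> \<not> Q z))"
    by (intro recp_not recp_conj assms)
  then show ?thesis by simp
qed

lemma recp_imp:
  assumes "recp P" "recp Q" shows "recp (\<lambda>z. P z \<longrightarrow> Q z)"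
  unfolding imp_conv_disj by (intro recp_disj recp_not assms)

lemma recp_eq:
  assumes "recf f" "recf g" shows "recp (\<lambda>z. f z = g z)"
  unfolding eq_iff by (intro recp_conj recp_le assms)

section \<open>Bounded quantifiers and search\<close>

lemma recp_bex:
  assumes "recp (\<lambda>w. P (p1 w) (p2 w))" "recf f"
  shows "recp (\<lambda>z. \<exists>x<f z. P z x)"
proof -
  have "recf (\<lambda>z. \<Sum>x<f z. if P z x then 1 else 0)"
    using assms unfolding recp_def by (intro recf_sum)
  then have "recp (\<lambda>z. \<not> (\<Sum>x<f z. if P z x then 1 else 0) = (0::nat))"
    by (intro recp_not recp_eq_0)
  then show ?thesis
    by (rule back_subst[where P = recp]) auto
qed

lemma recp_ball:
  assumes "recp (\<lambda>w. P (p1 w) (p2 w))" "recf f"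
  shows "recp (\<lambda>z. \<forall>x<f z. P z x)"
  using recp_not[OF recp_bex[OF recp_not[OF assms(1)] assms(2)]] by simp

text \<open>Counts the \<open>j < n\<close> that lie strictly before the first \<open>x\<close> with
  \<open>P x\<close>. This is bounded minimization, with value \<open>n\<close> if there is no such
  \<open>x\<close> below \<open>n\<close>, written as a sum so that \<open>recf_sum\<close>
  applies.\<close>

definition bleast :: "nat \<Rightarrow> (nat \<Rightarrow> bool) \<Rightarrow> nat" where
  "bleast n P = (\<Sum>j<n. if \<exists>x<Suc j. P x then 0 else 1)"

lemma bleast_eq:
  assumes "P x" "\<forall>y<x. \<not> P y" "x < n"
  shows "bleast n P = x"
proof -
  have "bleast n P = (\<Sum>j<n. if j < x then 1 else 0)"
    unfolding bleast_def using assms by (intro sum.cong) (auto simp: less_Suc_eq_le, meson leI)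
  also have "\<dots> = (\<Sum>j\<in>{..<n} \<inter> {j. j < x}. 1)"
    by (subst sum.inter_restrict) auto
  also have "{..<n} \<inter> {j. j < x} = {..<x}" using assms by auto
  finally show ?thesis by simp
qed

lemma recf_bleast:
  assumes "recp (\<lambda>w. P (p1 w) (p2 w))" "recf f"
  shows "recf (\<lambda>z. bleast (f z) (P z))"
proof -
  have "recp (\<lambda>w. \<exists>x<Suc (p2 w). P (p1 w) x)"
    by (rule recp_bex) (use recf_comp[OF assms(1)[unfolded recp_def],
        of "\<lambda>w. pr (p1 (p1 w)) (p2 w)"] in \<open>simp_all add: recp_def recf_basic\<close>)
  then show ?thesis
    unfolding bleast_def by (intro recf_sum recf_if recf_const assms)
qed

lemmas rec_intros = recf_basic recf_if recf_add recf_diff recf_pow2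
  recp_not recp_le recp_less recp_conj recp_disj recp_imp recp_eq

lemma recf_comp2:
  assumes "recf (\<lambda>w. F (p1 w) (p2 w))" "recf f" "recf g"
  shows "recf (\<lambda>z. F (f z) (g z))"
  using recf_comp[OF assms(1) recf_pr[OF assms(2,3)]] by simp

lemma recp_comp: "recp P \<Longrightarrow> recf f \<Longrightarrow> recp (\<lambda>z. P (f z))"
  unfolding recp_def by (rule recf_comp)

text \<open>Normal form for partial recursive functions: \<open>Mu\<close> finds the least
  \<open>t\<close>, and a total function computes the output from \<open>x\<close> and
  \<open>t\<close>. Both the r.e. set to be reduced and the machine giving short descriptions are
  obtained in this form.\<close>

lemma partial_recursive_search:
  assumes "recp (\<lambda>w. R (p1 w) (p2 w))" "recf (\<lambda>w. h (p1 w) (p2 w))"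
  shows "partial_recursive (\<lambda>x. if \<exists>t. R x t then Some (h x (LEAST t. R x t)) else None)"
proof -
  \<comment> \<open>Truth is coded by 0 here, because \<open>Mu\<close> looks for a zero.\<close>
  have "recf (\<lambda>w. if R (p1 w) (p2 w) then 0 else 1)"
    by (intro recf_if assms recf_const)
  then obtain r where r: "oracle_free r" "\<And>w. \<exists>Q. run {} r w (if R (p1 w) (p2 w) then 0 else 1) Q"
    unfolding recf_def by blast
  from assms(2) obtain e where e: "oracle_free e" "\<And>w. \<exists>Q. run {} e w (h (p1 w) (p2 w)) Q"
    unfolding recf_def by blast
  from recf_id obtain i where i: "oracle_free i" "\<And>x. \<exists>Q. run {} i x x Q"
    unfolding recf_def by blast
  let ?g = "Comp e (Pair i (Mu r))"
  have "\<exists>Q. run {} r (prod_encode (x, t)) (if R x t then 0 else 1) Q" for x t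
    using r(2)[of "pr x t"] unfolding p1_pr p2_pr by (simp only: pr_def)
  then have val: "(\<exists>Q. run {} r (prod_encode (x, t)) y Q) \<longleftrightarrow> y = (if R x t then 0 else 1)" for x t y
    using run_deterministic by blast
  have R: "R x t \<longleftrightarrow> (\<exists>Q. run {} r (prod_encode (x, t)) 0 Q)" for x t
    unfolding val by simp
  have nR: "\<not> R x t \<longleftrightarrow> (\<exists>v Q. run {} r (prod_encode (x, t)) (Suc v) Q)" for x t
    unfolding val by simp
  have mu: "(\<exists>Q. run {} (Mu r) x t Q) \<longleftrightarrow> R x t \<and> (\<forall>i<t. \<not> R x i)" for x t
  proof
    assume "\<exists>Q. run {} (Mu r) x t Q"
    then show "R x t \<and> (\<forall>i<t. \<not> R x i)"
      by (auto elim!: run_MuE simp: R nR) (metis R nR)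
  next
    assume a: "R x t \<and> (\<forall>i<t. \<not> R x i)"
    then have "\<exists>v Q. run {} r (prod_encode (x, i)) (Suc v) Q" if "i < t" for i
      using that nR by blast
    then obtain v Q where vQ: "\<And>i. i < t \<Longrightarrow> run {} r (prod_encode (x, i)) (Suc (v i)) (Q i)"
      by metis
    from a R obtain Q0 where "run {} r (prod_encode (x, t)) 0 Q0" by blast
    then have "run {} (Mu r) x t (\<Union>i\<le>t. (Q(t := Q0)) i)"
      by (intro run_Mu[where v = v]) (auto simp: vQ)
    then show "\<exists>Q. run {} (Mu r) x t Q" by blast
  qed
  have least: "R x t \<and> (\<forall>i<t. \<not> R x i) \<longleftrightarrow> (\<exists>t. R x t) \<and> t = (LEAST t. R x t)" for x t
    by (metis LeastI_ex not_less_Least linorder_neqE_nat)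
  have "(\<exists>Q. run {} ?g x y Q) \<longleftrightarrow> (\<exists>t. R x t) \<and> y = h x (LEAST t. R x t)" for x y
  proof
    assume "\<exists>Q. run {} ?g x y Q"
    then obtain t Q1 Q2 Q3 x' where *: "run {} (Mu r) x t Q1" "run {} i x x' Q3" "run {} e (prod_encode (x', t)) y Q2"
      by (auto elim!: run_PairE run_CompE)
    have "x' = x" using i(2) *(2) run_deterministic by blast
    then have "y = h x t" using *(3) e(2)[of "pr x t"] run_deterministic
      by (fastforce simp: pr_def p1_def p2_def)
    moreover have "(\<exists>t. R x t) \<and> t = (LEAST t. R x t)"
      using *(1) mu least by blast
    ultimately show "(\<exists>t. R x t) \<and> y = h x (LEAST t. R x t)" by blast
  next
    assume a: "(\<exists>t. R x t) \<and> y = h x (LEAST t. R x t)"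
    then obtain Q1 where "run {} (Mu r) x (LEAST t. R x t) Q1"
      using mu least by blast
    then show "\<exists>Q. run {} ?g x y Q"
      using a i(2)[of x] e(2)[of "pr x (LEAST t. R x t)"]
      by (fastforce simp: pr_def p1_def p2_def intro: run_Comp run_Pair)
  qed
  then show ?thesis
    unfolding partial_recursive_def using e(1) i(1) r(1)
    by (intro exI[of _ ?g]) auto
qed

lemma re_set_ex:
  assumes "recp (\<lambda>w. R (p1 w) (p2 w))"
  shows "re_set {x. \<exists>t. R x t}"
  using partial_recursive_search[OF assms recf_const]
  unfolding re_set_def by (auto simp: dom_def split: if_splits intro!: exI[of _ "\<lambda>x. if \<exists>t. R x t then Some 0 else None"])


subsection \<open>A universal machine\<close>

text \<open>
  A program is executed by a machine whose state \<open>pr K v\<close> consists of a stack \<open>K\<close> of tasks and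
  a current value \<open>v\<close>; it has halted when the stack is empty.  A task \<open>pr t a\<close> has a tag \<open>t\<close>
  and an argument \<open>a\<close>.  The tags below 9 are those of programs to be applied to the current value;
  the tags 9 and 10 are the two continuations of \<^const>\<open>Pair\<close>, and 11 and 12 are the
  continuations of \<^const>\<open>PrimRec\<close> and \<^const>\<open>Mu\<close>.
\<close>

primrec code :: "prog \<Rightarrow> nat" where
  "code Zero = pr 0 0"
| "code Succ = pr 1 0"
| "code Fst = pr 2 0"
| "code Snd = pr 3 0"
| "code Oracle = pr 4 0"
| "code (Pair e f) = pr 5 (pr (code e) (code f))"
| "code (Comp e f) = pr 6 (pr (code e) (code f))"
| "code (PrimRec e f) = pr 7 (pr (code e) (code f))"
| "code (Mu e) = pr 8 (code e)"

text \<open>A stack is a coded list; the successor separates a nonempty stack from the empty one,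
  which is 0.\<close>

definition push :: "nat \<Rightarrow> nat \<Rightarrow> nat" where "push a K = Suc (pr a K)"

text \<open>The oracle is an arbitrary function, so the same machine also runs with computable
  approximations of a set. For tag 7 with a positive counter the task pushes itself again with the
  counter decreased; tag 12 carries the program, the input and the current candidate for the
  zero.\<close>

definition exec :: "(nat \<Rightarrow> nat) \<Rightarrow> nat \<Rightarrow> nat \<Rightarrow> nat \<Rightarrow> nat \<Rightarrow> nat" where
  "exec orc t a K v =
    (if t = 0 then pr K 0
     else if t = 1 then pr K (Suc v)
     else if t = 2 then pr K (p1 v)
     else if t = 3 then pr K (p2 v)
     else if t = 4 then pr K (orc v)
     else if t = 5 then pr (push (p1 a) (push (pr 9 (pr (p2 a) v)) K)) v
     else if t = 6 then pr (push (p2 a) (push (p1 a) K)) v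
     else if t = 7 then
       (if p2 v = 0 then pr (push (p1 a) K) (p1 v)
        else pr (push (pr 7 a) (push (pr 11 (pr (p2 a) (pr (p1 v) (p2 v - 1)))) K))
               (pr (p1 v) (p2 v - 1)))
     else if t = 8 then pr (push a (push (pr 12 (pr a (pr v 0))) K)) (pr v 0)
     else if t = 9 then pr (push (p1 a) (push (pr 10 v) K)) (p2 a)
     else if t = 10 then pr K (pr a v)
     else if t = 11 then pr (push (p1 a) K) (pr (p1 (p2 a)) (pr (p2 (p2 a)) v))
     else if v = 0 then pr K (p2 (p2 a))
     else pr (push (p1 a) (push (pr 12 (pr (p1 a) (pr (p1 (p2 a)) (Suc (p2 (p2 a)))))) K))
            (pr (p1 (p2 a)) (Suc (p2 (p2 a)))))"

definition step :: "(nat \<Rightarrow> nat) \<Rightarrow> nat \<Rightarrow> nat" where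
  "step orc s = (if p1 s = 0 then s
     else exec orc (p1 (p1 (p1 s - 1))) (p2 (p1 (p1 s - 1))) (p2 (p1 s - 1)) (p2 s))"

section \<open>Iterating the machine\<close>

definition iter :: "(nat \<Rightarrow> nat) \<Rightarrow> nat \<Rightarrow> nat \<Rightarrow> nat" where
  "iter orc s t = (step orc ^^ t) s"

lemma step_halted: "step orc (pr 0 v) = pr 0 v"
  by (simp add: step_def)

lemma step_push: "step orc (pr (push (pr t a) K) v) = exec orc t a K v"
  by (simp add: step_def push_def)

lemma iter_0 [simp]: "iter orc s 0 = s"
  by (simp add: iter_def)

lemma iter_Suc: "iter orc s (Suc t) = iter orc (step orc s) t"
  by (simp add: iter_def funpow_swap1)

lemma iter_add: "iter orc s (t + u) = iter orc (iter orc s t) u"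
  by (simp add: iter_def add.commute[of t] funpow_add)

lemma iter_halted: "iter orc (pr 0 v) t = pr 0 v"
  by (induction t) (simp_all add: iter_Suc step_halted)

lemma iter_halted_mono:
  assumes "p1 (iter orc s t) = 0" "t \<le> t'"
  shows "iter orc s t' = iter orc s t"
proof -
  have "iter orc s t' = iter orc (pr (p1 (iter orc s t)) (p2 (iter orc s t))) (t' - t)"
    using assms(2) iter_add[of orc s t "t' - t"] by simp
  then show ?thesis
    using assms(1) iter_halted by (metis pr_p1_p2)
qed

lemma iter_halted_unique:
  assumes "p1 (iter orc s t) = 0" "p1 (iter orc s t') = 0"
  shows "iter orc s t' = iter orc s t"
  using iter_halted_mono[OF assms(1), of t'] iter_halted_mono[OF assms(2), of t]
  by (cases "t \<le> t'") auto

definition reaches :: "(nat \<Rightarrow> nat) \<Rightarrow> nat \<Rightarrow> nat \<Rightarrow> bool" where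
  "reaches orc s s' \<longleftrightarrow> (\<exists>t. iter orc s t = s')"

lemma reaches_refl: "reaches orc s s"
  unfolding reaches_def by (metis iter_0)

lemma reaches_trans: "reaches orc s s' \<Longrightarrow> reaches orc s' s'' \<Longrightarrow> reaches orc s s''"
  unfolding reaches_def by (metis iter_add)

lemma reaches_step: "reaches orc (step orc s) s' \<Longrightarrow> reaches orc s s'"
  unfolding reaches_def by (metis iter_Suc)

lemma reaches_push: "reaches orc (exec orc t a K v) s' \<Longrightarrow> reaches orc (pr (push (pr t a) K) v) s'"
  using reaches_step by (simp add: step_push)

text \<open>The stack \<open>K\<close> is arbitrary because subprograms run on top of pending
  continuations. The oracle has to be right only on the recorded queries, which later lets a cut-off
  oracle replace the full set.\<close>

lemma run_reaches:
  "run A e x y Q \<Longrightarrow> (\<forall>q\<in>Q. orc q = (if q \<in> A then 1 else 0)) \<Longrightarrow>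
    reaches orc (pr (push (code e) K) x) (pr K y)"
proof (induction arbitrary: K rule: run.induct)
  case (run_Pair e x y Q f z R)
  have 1: "reaches orc (pr (push (code e) K') x) (pr K' y)"
    and 2: "reaches orc (pr (push (code f) K') x) (pr K' z)" for K'
    using run_Pair by auto
  show ?case
    unfolding code.simps
    by (rule reaches_push, simp add: exec_def, rule reaches_trans[OF 1], rule reaches_push,
        simp add: exec_def, rule reaches_trans[OF 2], rule reaches_push)
      (simp add: exec_def pr_def reaches_refl)
next
  case (run_Comp f x y Q e z R)
  have 1: "reaches orc (pr (push (code f) K') x) (pr K' y)"
    and 2: "reaches orc (pr (push (code e) K') y) (pr K' z)" for K'
    using run_Comp by auto
  show ?case
    unfolding code.simps
    by (rule reaches_push, simp add: exec_def, rule reaches_trans[OF 1], rule 2)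
next
  case (run_PrimRec_0 e x y Q f)
  have 1: "reaches orc (pr (push (code e) K') x) (pr K' y)" for K'
    using run_PrimRec_0 by auto
  show ?case
    unfolding code.simps pr_def[symmetric]
    by (rule reaches_push, simp add: exec_def, rule 1)
next
  case (run_PrimRec_Suc e f x n y Q z R)
  have 1: "reaches orc (pr (push (code (PrimRec e f)) K') (pr x n)) (pr K' y)"
    and 2: "reaches orc (pr (push (code f) K') (pr x (pr n y))) (pr K' z)" for K'
    using run_PrimRec_Suc by (auto simp: pr_def)
  show ?case
    unfolding code.simps pr_def[symmetric]
    by (rule reaches_push, simp add: exec_def, rule reaches_trans[OF 1[unfolded code.simps]],
        rule reaches_push, simp add: exec_def, rule 2)
next
  case (run_Mu e x n Q v)
  have 1: "reaches orc (pr (push (code e) K') (pr x n)) (pr K' 0)" for K'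
    unfolding pr_def[of x] using run_Mu.IH(1) run_Mu.prems by auto
  have 2: "reaches orc (pr (push (code e) K') (pr x i)) (pr K' (Suc (v i)))" if "i < n" for i K'
    unfolding pr_def[of x] by (rule run_Mu.IH(2)[OF that]) (meson run_Mu.prems that UN_I atMost_iff less_imp_le)
  \<comment> \<open>The machine state at which the candidate \<open>i\<close> starts to be
    tested.\<close>
  let ?s = "\<lambda>i. pr (push (code e) (push (pr 12 (pr (code e) (pr x i))) K)) (pr x i)"
  have "i \<le> n \<Longrightarrow> reaches orc (?s 0) (?s i)" for i
  proof (induction i)
    case 0
    show ?case by (rule reaches_refl)
  next
    case (Suc i)
    have "reaches orc (?s i) (?s (Suc i))"
      by (rule reaches_trans[OF 2], use Suc in simp, rule reaches_push)
        (simp add: exec_def reaches_refl)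
    then show ?case using Suc by (auto intro: reaches_trans)
  qed
  moreover have "reaches orc (?s n) (pr K n)"
    by (rule reaches_trans[OF 1], rule reaches_push) (simp add: exec_def reaches_refl)
  ultimately have "reaches orc (?s 0) (pr K n)"
    by (blast intro: reaches_trans)
  then show ?case
    unfolding code.simps by (intro reaches_push) (simp add: exec_def)
qed (auto intro!: reaches_push simp: exec_def reaches_refl p1_def p2_def)

section \<open>Evaluation with a step budget\<close>

definition ev :: "(nat \<Rightarrow> nat) \<Rightarrow> nat \<Rightarrow> nat \<Rightarrow> nat \<Rightarrow> nat" where
  "ev orc e x t = iter orc (pr (push e 0) x) t"

lemma ev_complete:
  assumes "run A e x y Q" "\<forall>q\<in>Q. orc q = (if q \<in> A then 1 else 0)"
  shows "\<exists>t0. \<forall>t\<ge>t0. ev orc (code e) x t = pr 0 y"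
proof -
  obtain t0 where "ev orc (code e) x t0 = pr 0 y"
    using run_reaches[OF assms, of 0] unfolding reaches_def ev_def by blast
  then have "ev orc (code e) x t = pr 0 y" if "t \<ge> t0" for t
    using that iter_halted_mono[of orc _ t0 t] unfolding ev_def by simp
  then show ?thesis by blast
qed

lemma ev_halted_mono: "p1 (ev orc e x t) = 0 \<Longrightarrow> t \<le> t' \<Longrightarrow> ev orc e x t' = ev orc e x t"
  unfolding ev_def by (rule iter_halted_mono)

lemma ev_halted_unique:
  "p1 (ev orc e x t) = 0 \<Longrightarrow> p1 (ev orc e x t') = 0 \<Longrightarrow> ev orc e x t' = ev orc e x t"
  unfolding ev_def by (rule iter_halted_unique)

definition halts_in :: "(nat \<Rightarrow> nat) \<Rightarrow> nat \<Rightarrow> nat \<Rightarrow> bool" where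
  "halts_in orc s t \<longleftrightarrow> p1 (iter orc s t) = 0"

lemma halts_in_push:
  assumes "halts_in orc (pr (push (pr tg a) K) v) t"
  obtains t' where "t' < t" "halts_in orc (exec orc tg a K v) t'"
proof (cases t)
  case 0
  then show ?thesis using assms by (simp add: halts_in_def push_def)
next
  case (Suc t')
  then show ?thesis using assms that[of t'] by (simp add: halts_in_def iter_Suc step_push)
qed

text \<open>Converse of \<open>run_reaches\<close>. The induction is on the number of remaining
  steps, not on the program, since \<open>PrimRec\<close> calls itself: each subcomputation gives
  the stack back strictly before the whole run halts.\<close>

lemma halts_in_run:
  assumes orc: "\<forall>q. orc q = (if q \<in> A then 1 else 0)"
  shows "halts_in orc (pr (push (code e) K) x) t \<Longrightarrow>
    \<exists>y Q. \<exists>t'<t. run A e x y Q \<and> halts_in orc (pr K y) t'"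
proof (induction t arbitrary: e K x rule: less_induct)
  case (less t)
  show ?case
  proof (cases e)
    case Zero
    with less.prems obtain t1 where "t1 < t" "halts_in orc (pr K 0) t1"
      by (auto elim!: halts_in_push simp: exec_def)
    then show ?thesis using Zero by (auto intro: run_Zero)
  next
    case Succ
    with less.prems obtain t1 where "t1 < t" "halts_in orc (pr K (Suc x)) t1"
      by (auto elim!: halts_in_push simp: exec_def)
    then show ?thesis using Succ by (auto intro: run_Succ)
  next
    case Fst
    with less.prems obtain t1 where "t1 < t" "halts_in orc (pr K (p1 x)) t1"
      by (auto elim!: halts_in_push simp: exec_def)
    then show ?thesis using Fst run_Fst unfolding p1_def by blast
  next
    case Snd
    with less.prems obtain t1 where "t1 < t" "halts_in orc (pr K (p2 x)) t1"
      by (auto elim!: halts_in_push simp: exec_def)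
    then show ?thesis using Snd run_Snd unfolding p2_def by blast
  next
    case Oracle
    with less.prems obtain t1 where "t1 < t" "halts_in orc (pr K (orc x)) t1"
      by (auto elim!: halts_in_push simp: exec_def)
    then show ?thesis using Oracle run_Oracle[of A x] orc by metis
  next
    case (Pair f g)
    from less.prems obtain t1 where 1: "t1 < t"
      "halts_in orc (pr (push (code f) (push (pr 9 (pr (code g) x)) K)) x) t1"
      unfolding Pair code.simps by (rule halts_in_push) (auto simp: exec_def)
    from less.IH[OF this] obtain y Q t2 where 2: "t2 < t1" "run A f x y Q"
      "halts_in orc (pr (push (pr 9 (pr (code g) x)) K) y) t2" by blast
    from 2(3) obtain t3 where 3: "t3 < t2" "halts_in orc (pr (push (code g) (push (pr 10 y) K)) x) t3"
      by (rule halts_in_push) (auto simp: exec_def)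
    have "t3 < t" using 1 2 3 by simp
    from less.IH[OF this 3(2)] obtain z R t4 where 4: "t4 < t3" "run A g x z R"
      "halts_in orc (pr (push (pr 10 y) K) z) t4" by blast
    from 4(3) obtain t5 where 5: "t5 < t4" "halts_in orc (pr K (pr y z)) t5"
      by (rule halts_in_push) (auto simp: exec_def)
    have "t5 < t" using 1 2 3 4 5 by simp
    moreover have "run A e x (pr y z) (Q \<union> R)"
      unfolding Pair pr_def using 2(2) 4(2) by (rule run_Pair)
    ultimately show ?thesis using 5(2) by blast
  next
    case (Comp f g)
    from less.prems obtain t1 where 1: "t1 < t"
      "halts_in orc (pr (push (code g) (push (code f) K)) x) t1"
      unfolding Comp code.simps by (rule halts_in_push) (auto simp: exec_def)
    from less.IH[OF this] obtain y Q t2 where 2: "t2 < t1" "run A g x y Q"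
      "halts_in orc (pr (push (code f) K) y) t2" by blast
    have "t2 < t" using 1 2 by simp
    from less.IH[OF this 2(3)] obtain z R t3 where 3: "t3 < t2" "run A f y z R"
      "halts_in orc (pr K z) t3" by blast
    have "t3 < t" using 1 2 3 by simp
    moreover have "run A e x z (Q \<union> R)"
      unfolding Comp using 2(2) 3(2) by (rule run_Comp)
    ultimately show ?thesis using 3(3) by blast
  next
    case (PrimRec f g)
    define w where "w = p1 x"
    show ?thesis
    proof (cases "p2 x")
      case 0
      then have x: "x = pr w 0" unfolding w_def by (metis pr_p1_p2)
      from less.prems obtain t1 where 1: "t1 < t" "halts_in orc (pr (push (code f) K) w) t1"
        unfolding PrimRec code.simps x by (rule halts_in_push) (auto simp: exec_def)
      from less.IH[OF this] obtain y Q t2 where 2: "t2 < t1" "run A f w y Q"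
        "halts_in orc (pr K y) t2" by blast
      have "run A e x y Q"
        unfolding PrimRec x pr_def using 2(2) by (rule run_PrimRec_0)
      then show ?thesis using 1 2 less_trans by blast
    next
      case (Suc n)
      then have x: "x = pr w (Suc n)" unfolding w_def by (metis pr_p1_p2)
      from less.prems obtain t1 where 1: "t1 < t"
        "halts_in orc (pr (push (code e) (push (pr 11 (pr (code g) (pr w n))) K)) (pr w n)) t1"
        unfolding PrimRec code.simps x by (rule halts_in_push) (auto simp: exec_def)
      from less.IH[OF this] obtain y Q t2 where 2: "t2 < t1" "run A e (pr w n) y Q"
        "halts_in orc (pr (push (pr 11 (pr (code g) (pr w n))) K) y) t2" by blast
      from 2(3) obtain t3 where 3: "t3 < t2" "halts_in orc (pr (push (code g) K) (pr w (pr n y))) t3"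
        by (rule halts_in_push) (auto simp: exec_def)
      have "t3 < t" using 1 2 3 by simp
      from less.IH[OF this 3(2)] obtain z R t4 where 4: "t4 < t3" "run A g (pr w (pr n y)) z R"
        "halts_in orc (pr K z) t4" by blast
      have "t4 < t" using 1 2 3 4 by simp
      moreover have "run A e x z (Q \<union> R)"
        using 2(2) 4(2) unfolding PrimRec x pr_def by (rule run_PrimRec_Suc)
      ultimately show ?thesis using 4(3) by blast
    qed
  next
    case (Mu f)
    let ?s = "\<lambda>i. pr (push (code f) (push (pr 12 (pr (code f) (pr x i))) K)) (pr x i)"
    \<comment> \<open>Inner induction along the search: the candidates below \<open>n\<close> have
      already produced nonzero values, and fewer steps remain for the next one.\<close>
    have loop: "\<exists>y Q. \<exists>t'<t. run A e x y Q \<and> halts_in orc (pr K y) t'"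
      if "t1 < t" "halts_in orc (?s n) t1" "\<forall>i<n. \<exists>v Q. run A f (pr x i) (Suc v) Q" for t1 n
      using that
    proof (induction t1 arbitrary: n rule: less_induct)
      case (less t1)
      from \<open>\<And>y e K x. y < t \<Longrightarrow> halts_in orc (pr (push (code e) K) x) y \<Longrightarrow> _\<close>[OF less.prems(1,2)]
      obtain y Q t2 where 2: "t2 < t1" "run A f (pr x n) y Q"
        "halts_in orc (pr (push (pr 12 (pr (code f) (pr x n))) K) y) t2" by blast
      from 2(3) obtain t3 where 3: "t3 < t2" "halts_in orc (exec orc 12 (pr (code f) (pr x n)) K y) t3"
        by (rule halts_in_push)
      have t3: "t3 < t1" "t3 < t" using 2 3 less.prems by simp_all
      show ?case
      proof (cases y)
        case 0
        obtain v R where "\<And>i. i < n \<Longrightarrow> run A f (pr x i) (Suc (v i)) (R i)"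
          using less.prems(3) by metis
        with 2(2) 0 have "run A (Mu f) x n (\<Union>i\<le>n. (R(n := Q)) i)"
          by (intro run_Mu[where v = v]) (auto simp: pr_def)
        then show ?thesis using 3 0 t3 Mu by (auto simp: exec_def)
      next
        case (Suc v)
        show ?thesis
          by (rule less.IH[of t3 "Suc n"]) (use t3 less.prems 2 3 Suc in \<open>auto simp: exec_def less_Suc_eq\<close>)
      qed
    qed
    from less.prems obtain t1 where "t1 < t" "halts_in orc (?s 0) t1"
      unfolding Mu code.simps by (rule halts_in_push) (auto simp: exec_def)
    then show ?thesis by (rule loop) simp
  qed
qed

lemma ev_sound:
  assumes "p1 (ev (\<lambda>_. 0) (code e) x t) = 0"
  shows "\<exists>y Q. run {} e x y Q"
  using halts_in_run[of "\<lambda>_. 0" "{}" e 0 x t] assms unfolding halts_in_def ev_def by auto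

section \<open>Recursiveness of the machine\<close>

lemma recf_step:
  assumes "recf (\<lambda>w. h (p1 w) (p2 w))" "recf f" "recf g"
  shows "recf (\<lambda>z. step (h (f z)) (g z))"
proof -
  note h = recf_comp2[of h, OF assms(1)]
  have "recf (\<lambda>w. step (h (p1 w)) (p2 w))"
    unfolding step_def exec_def push_def by (intro rec_intros h)
  from recf_comp2[OF this assms(2,3)] show ?thesis .
qed

text \<open>The oracle is a member of a uniformly recursive family \<open>h\<close>, selected by the
  number \<open>c z\<close>; this permits oracles that change with the stage.\<close>

lemma recf_ev:
  assumes "recf (\<lambda>w. h (p1 w) (p2 w))" "recf c" "recf e" "recf f" "recf g"
  shows "recf (\<lambda>z. ev (h (c z)) (e z) (f z) (g z))"
proof -
  have "recf (\<lambda>z. rec_nat (pr (push (e z) 0) (f z)) (\<lambda>n y. step (h (c z)) y) (g z))"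
    unfolding push_def
    by (intro recf_rec_nat rec_intros assms recf_step recf_comp[OF assms(2)])
  moreover have "rec_nat (pr (push e 0) x) (\<lambda>n y. step orc y) t = ev orc e x t" for orc e x t
    unfolding ev_def iter_def by (induction t) auto
  ultimately show ?thesis by simp
qed

lemma recf_comp3:
  assumes "recf (\<lambda>w. F (p1 w) (p1 (p2 w)) (p2 (p2 w)))" "recf f" "recf g" "recf h"
  shows "recf (\<lambda>z. F (f z) (g z) (h z))"
  using recf_comp[OF assms(1) recf_pr[OF assms(2) recf_pr[OF assms(3,4)]]] by simp

lemma recp_comp3:
  assumes "recp (\<lambda>w. F (p1 w) (p1 (p2 w)) (p2 (p2 w)))" "recf f" "recf g" "recf h"
  shows "recp (\<lambda>z. F (f z) (g z) (h z))"
  using recp_comp[OF assms(1) recf_pr[OF assms(2) recf_pr[OF assms(3,4)]]] by simp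

lemma recp_comp4:
  assumes "recp (\<lambda>w. F (p1 w) (p1 (p2 w)) (p1 (p2 (p2 w))) (p2 (p2 (p2 w))))"
    "recf f" "recf g" "recf h" "recf i"
  shows "recp (\<lambda>z. F (f z) (g z) (h z) (i z))"
  using recp_comp[OF assms(1) recf_pr[OF assms(2) recf_pr[OF assms(3) recf_pr[OF assms(4,5)]]]]
  by simp

lemma recp_comp5:
  assumes "recp (\<lambda>w. F (p1 w) (p1 (p2 w)) (p1 (p2 (p2 w))) (p1 (p2 (p2 (p2 w)))) (p2 (p2 (p2 (p2 w)))))"
    "recf f" "recf g" "recf h" "recf i" "recf j"
  shows "recp (\<lambda>z. F (f z) (g z) (h z) (i z) (j z))"
  using recp_comp[OF assms(1) recf_pr[OF assms(2) recf_pr[OF assms(3) recf_pr[OF assms(4)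
    recf_pr[OF assms(5,6)]]]]]
  by simp


subsection \<open>The diagonal set\<close>

text \<open>\<open>a\<close> codes a program with domain \<open>X\<close>; \<open>u\<close> stands
  for the code of a program computing the optimal machine.\<close>

locale construction =
  fixes a u :: nat and X :: "nat set"
  assumes enum: "x \<in> X \<longleftrightarrow> (\<exists>t. p1 (ev (\<lambda>_. 0) a x t) = 0)"
begin

definition enumerated :: "nat \<Rightarrow> nat \<Rightarrow> bool" where
  "enumerated t x \<longleftrightarrow> p1 (ev (\<lambda>_. 0) a x t) = 0"

text \<open>The index \<open>c\<close> packs the cut-off and the stage into one number, as
  \<open>recf_ev\<close> expects.\<close>

definition approx :: "nat \<Rightarrow> nat \<Rightarrow> nat" where
  "approx c q = (if q < p1 c \<and> enumerated (p2 c) q then 1 else 0)"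

definition witness :: "nat \<Rightarrow> nat \<Rightarrow> nat \<Rightarrow> nat" where
  "witness k n i = pr k (pr n i)"

text \<open>The numbers 2 and 3 encode the answers 0 and 1.\<close>

definition correct :: "nat \<Rightarrow> nat \<Rightarrow> nat \<Rightarrow> bool" where
  "correct m p t \<longleftrightarrow> (\<forall>z<m. p1 (ev (\<lambda>_. 0) u (pr p z) t) = 0 \<and>
     (p2 (ev (\<lambda>_. 0) u (pr p z) t) = 3 \<longrightarrow> enumerated t z) \<and>
     (p2 (ev (\<lambda>_. 0) u (pr p z) t) = 2 \<longrightarrow> \<not> enumerated t z))"

text \<open>There are \<open>2 ^ n - 1\<close> strings of length less than \<open>n\<close>, and
  they are exactly the strings numbered below this bound.\<close>

definition covered :: "nat \<Rightarrow> nat \<Rightarrow> nat \<Rightarrow> nat \<Rightarrow> bool" where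
  "covered n m x t \<longleftrightarrow> (\<exists>p<2 ^ n - 1. correct m p t \<and> p2 (ev (\<lambda>_. 0) u (pr p x) t) = 3)"

text \<open>\<open>k\<close> packs the code of a reduction and the code of its use bound;
  \<open>pr 0 0\<close> is the halted state with output 0.\<close>

definition rejected :: "nat \<Rightarrow> nat \<Rightarrow> nat \<Rightarrow> nat \<Rightarrow> nat \<Rightarrow> bool" where
  "rejected k n m i t \<longleftrightarrow> ev (approx (pr m t)) (p1 k) (witness k n i) t = pr 0 0"

text \<open>A level alternates between waiting for an element below the cut-off to enter
  \<open>X\<close> and waiting until that element is covered and the next witness is rejected.
  Elements are stored with a successor, so that 0 can mean that none has been found.\<close>

definition advance :: "nat \<Rightarrow> nat \<Rightarrow> nat \<Rightarrow> nat" where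
  "advance c t s =
    (if p2 (p2 s) = 0 then
       if \<exists>x<p2 (p2 c). enumerated t x \<and> \<not> enumerated (p1 (p2 s)) x
       then pr (p1 s) (pr (p1 (p2 s))
         (Suc (bleast (p2 (p2 c)) (\<lambda>x. enumerated t x \<and> \<not> enumerated (p1 (p2 s)) x))))
       else s
     else if (p1 s = 0 \<or> covered (p1 (p2 c)) (p2 (p2 c)) (p2 (p2 s) - 1) t) \<and>
         rejected (p1 c) (p1 (p2 c)) (p2 (p2 c)) (p1 s) t
       then pr (Suc (p1 s)) (pr t 0) else s)"

text \<open>
  In a state \<open>pr i (pr d y)\<close> of level \<open>c = pr k (pr n m)\<close>, the first \<open>i\<close> witnesses of
  the level have been put into the constructed set, the last of them at stage \<open>d\<close>.  If \<open>y = 0\<close>,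
  no element below \<open>m\<close> has entered \<open>X\<close> since stage \<open>d\<close>; otherwise \<open>y - 1\<close> is such an element.
  The initial state with \<open>i = 0\<close> is an exception: there \<open>y = 1\<close> only means that the first
  witness can be put in without any element being covered.
\<close>

primrec state :: "nat \<Rightarrow> nat \<Rightarrow> nat" where
  "state c 0 = pr 0 (pr 0 1)"
| "state c (Suc t) = advance c t (state c t)"

definition bound_halts :: "nat \<Rightarrow> nat \<Rightarrow> nat \<Rightarrow> bool" where
  "bound_halts k n t \<longleftrightarrow> (\<forall>j<Suc (2 ^ n). p1 (ev (\<lambda>_. 0) (p2 k) (witness k n j) t) = 0)"

text \<open>The sum serves as a common upper bound for the use on all witnesses of the level. It is
  meaningful only once \<open>bound_halts\<close> holds.\<close>

definition bound :: "nat \<Rightarrow> nat \<Rightarrow> nat \<Rightarrow> nat" where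
  "bound k n t = (\<Sum>j<Suc (2 ^ n). p2 (ev (\<lambda>_. 0) (p2 k) (witness k n j) t))"

text \<open>The level is replayed from its start with the bound known at stage \<open>t\<close>.
  Once the use bounds have halted the bound no longer changes, and the replays are initial segments
  of one fixed run.\<close>

definition level :: "nat \<Rightarrow> nat \<Rightarrow> nat \<Rightarrow> nat" where
  "level k n t = state (pr k (pr n (bound k n t))) t"

definition diag_set :: "nat set" where
  "diag_set = {w. \<exists>t. bound_halts (p1 w) (p1 (p2 w)) t \<and> p2 (p2 w) < p1 (level (p1 w) (p1 (p2 w)) t)}"

section \<open>Recursiveness of the construction\<close>

lemma recf_ev_0:
  assumes "recf e" "recf f" "recf g"
  shows "recf (\<lambda>z. ev (\<lambda>_. 0) (e z) (f z) (g z))"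
  by (rule recf_ev[of "\<lambda>_ _. 0" "\<lambda>z. z"]) (intro rec_intros assms)+

lemma recp_enumerated: "recf f \<Longrightarrow> recf g \<Longrightarrow> recp (\<lambda>z. enumerated (f z) (g z))"
  unfolding enumerated_def by (intro rec_intros recf_ev_0)

lemma recf_approx: "recf (\<lambda>w. approx (p1 w) (p2 w))"
  unfolding approx_def by (intro rec_intros recp_enumerated)

lemma recp_correct: "recf f \<Longrightarrow> recf g \<Longrightarrow> recf h \<Longrightarrow> recp (\<lambda>z. correct (f z) (g z) (h z))"
  by (rule recp_comp3[of correct]) (unfold correct_def, intro recp_ball rec_intros recp_enumerated recf_ev_0)

lemma recp_covered:
  "recf f \<Longrightarrow> recf g \<Longrightarrow> recf h \<Longrightarrow> recf i \<Longrightarrow> recp (\<lambda>z. covered (f z) (g z) (h z) (i z))"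
  by (rule recp_comp4[of covered])
    (unfold covered_def, intro recp_bex rec_intros recp_correct recf_ev_0)

lemma recp_rejected:
  "recf f \<Longrightarrow> recf g \<Longrightarrow> recf h \<Longrightarrow> recf i \<Longrightarrow> recf j \<Longrightarrow>
    recp (\<lambda>z. rejected (f z) (g z) (h z) (i z) (j z))"
  by (rule recp_comp5[of rejected])
    (unfold rejected_def witness_def, intro rec_intros recf_ev[of approx] recf_approx)

lemma recf_state:
  assumes "recf f" "recf g"
  shows "recf (\<lambda>z. state (f z) (g z))"
proof (rule recf_comp2[of state])
  have "recf (\<lambda>w. rec_nat (pr 0 (pr 0 1)) (\<lambda>t s. advance (p1 w) t s) (p2 w))"
    unfolding advance_def
    by (intro recf_rec_nat rec_intros recp_bex recf_bleast recp_enumerated recp_covered recp_rejected)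
  moreover have "rec_nat (pr 0 (pr 0 1)) (\<lambda>t s. advance c t s) t = state c t" for c t
    by (induction t) auto
  ultimately show "recf (\<lambda>w. state (p1 w) (p2 w))" by simp
qed fact+

lemma recp_bound_halts:
  "recf f \<Longrightarrow> recf g \<Longrightarrow> recf h \<Longrightarrow> recp (\<lambda>z. bound_halts (f z) (g z) (h z))"
  by (rule recp_comp3[of bound_halts])
    (unfold bound_halts_def witness_def, intro recp_ball rec_intros recf_ev_0)

lemma recf_level:
  "recf f \<Longrightarrow> recf g \<Longrightarrow> recf h \<Longrightarrow> recf (\<lambda>z. level (f z) (g z) (h z))"
  by (rule recf_comp3[of level])
    (unfold level_def bound_def witness_def, intro recf_sum rec_intros recf_ev_0 recf_state)

lemma re_set_diag_set: "re_set diag_set"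
  unfolding diag_set_def
  by (intro re_set_ex rec_intros recp_bound_halts recf_level)

section \<open>The enumeration of \<open>X\<close> in the limit\<close>

lemma enumerated_mono: "enumerated t x \<Longrightarrow> t \<le> t' \<Longrightarrow> enumerated t' x"
  unfolding enumerated_def using ev_halted_mono by metis

lemma enumerated_in: "enumerated t x \<Longrightarrow> x \<in> X"
  using enum enumerated_def by blast

lemma enumerated_settled: "\<exists>T. \<forall>t\<ge>T. \<forall>x<m. enumerated t x \<longleftrightarrow> x \<in> X"
proof (induction m)
  case (Suc m)
  then obtain T where T: "\<forall>t\<ge>T. \<forall>x<m. enumerated t x \<longleftrightarrow> x \<in> X" by blast
  obtain T' where "\<forall>t\<ge>T'. enumerated t m \<longleftrightarrow> m \<in> X"
    using enum enumerated_mono unfolding enumerated_def[symmetric] by blast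
  with T show ?case
    by (intro exI[of _ "max T T'"]) (auto simp: less_Suc_eq)
qed simp

lemma approx_settled:
  assumes "\<forall>x<m. enumerated t x \<longleftrightarrow> x \<in> X"
  shows "approx (pr m t) = (\<lambda>q. if q < m \<and> q \<in> X then 1 else 0)"
  using assms by (auto simp: approx_def fun_eq_iff)

text \<open>All queries lie below \<open>m\<close>, and the approximation below \<open>m\<close> is
  eventually final; from then on a sufficient step budget reproduces the true computation.\<close>

lemma eval_approx_settled:
  assumes "run X e w v Q" "\<forall>q\<in>Q. q < m"
  shows "\<exists>T. \<forall>t\<ge>T. ev (approx (pr m t)) (code e) w t = pr 0 v"
proof -
  obtain T1 where T1: "\<forall>t\<ge>T1. \<forall>x<m. enumerated t x \<longleftrightarrow> x \<in> X"
    using enumerated_settled by blast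
  obtain T2 where "\<forall>t\<ge>T2. ev (\<lambda>q. if q < m \<and> q \<in> X then 1 else 0) (code e) w t = pr 0 v"
    using ev_complete[OF assms(1), of "\<lambda>q. if q < m \<and> q \<in> X then 1 else 0"] assms(2) by auto
  with T1 show ?thesis
    by (intro exI[of _ "max T1 T2"]) (auto simp: approx_settled)
qed


section \<open>The history of a single level\<close>

definition count :: "nat \<Rightarrow> nat \<Rightarrow> nat" where "count c t = p1 (state c t)"
definition snapshot :: "nat \<Rightarrow> nat \<Rightarrow> nat" where "snapshot c t = p1 (p2 (state c t))"
definition pending :: "nat \<Rightarrow> nat \<Rightarrow> nat" where "pending c t = p2 (p2 (state c t))"

lemma state_0 [simp]: "count c 0 = 0" "snapshot c 0 = 0" "pending c 0 = 1"
  by (simp_all add: count_def snapshot_def pending_def)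

text \<open>The three possible moves of a level; later arguments about its history use
  \<open>advance\<close> only through this rule.\<close>

lemma state_Suc_cases:
  fixes k n m t
  defines "c \<equiv> pr k (pr n m)"
  obtains (found) x where "pending c t = 0" "x < m" "enumerated t x" "\<not> enumerated (snapshot c t) x"
      "count c (Suc t) = count c t" "snapshot c (Suc t) = snapshot c t" "pending c (Suc t) = Suc x"
  | (next_witness) "pending c t \<noteq> 0" "count c t = 0 \<or> covered n m (pending c t - 1) t"
      "rejected k n m (count c t) t"
      "count c (Suc t) = Suc (count c t)" "snapshot c (Suc t) = t" "pending c (Suc t) = 0"
  | (idle) "pending c t = 0 \<longrightarrow> (\<forall>x<m. enumerated t x \<longrightarrow> enumerated (snapshot c t) x)"
      "pending c t \<noteq> 0 \<longrightarrow> \<not> ((count c t = 0 \<or> covered n m (pending c t - 1) t) \<and>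
        rejected k n m (count c t) t)"
      "count c (Suc t) = count c t" "snapshot c (Suc t) = snapshot c t" "pending c (Suc t) = pending c t"
proof (cases "pending c t = 0 \<and> (\<exists>x<m. enumerated t x \<and> \<not> enumerated (snapshot c t) x)")
  case True
  let ?P = "\<lambda>x. enumerated t x \<and> \<not> enumerated (snapshot c t) x"
  obtain x0 where x0: "x0 < m" "?P x0" using True by blast
  define x where "x = (LEAST x. ?P x)"
  have x: "?P x" "\<forall>y<x. \<not> ?P y" "x < m"
    unfolding x_def using LeastI[of ?P, OF x0(2)] not_less_Least[of _ ?P] Least_le[of ?P, OF x0(2)] x0(1)
    by (blast, blast, linarith)
  have "bleast m ?P = x" by (rule bleast_eq) fact+
  then have "state c (Suc t) = pr (count c t) (pr (snapshot c t) (Suc x))"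
    using True by (auto simp: advance_def count_def snapshot_def pending_def c_def)
  then show ?thesis
    using found[of x] x True by (simp add: count_def snapshot_def pending_def del: state.simps)
next
  case False
  show ?thesis
  proof (cases "pending c t \<noteq> 0 \<and> (count c t = 0 \<or> covered n m (pending c t - 1) t) \<and>
        rejected k n m (count c t) t")
    case True
    then have "state c (Suc t) = pr (Suc (count c t)) (pr t 0)"
      by (simp add: advance_def count_def snapshot_def pending_def c_def)
    then show ?thesis
      using next_witness True by (simp add: count_def snapshot_def pending_def del: state.simps)
  next
    case False2: False
    have "state c (Suc t) = state c t"
      using False False2 by (auto simp: advance_def count_def snapshot_def pending_def c_def)
    then show ?thesis
      using idle False False2 by (auto simp: count_def snapshot_def pending_def simp del: state.simps)
  qed
qed

lemma count_Suc_mono: "count (pr k (pr n m)) t \<le> count (pr k (pr n m)) (Suc t)"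
  by (cases rule: state_Suc_cases[of k n m t]) simp_all

lemma count_mono: "t \<le> t' \<Longrightarrow> count (pr k (pr n m)) t \<le> count (pr k (pr n m)) t'"
  by (rule lift_Suc_mono_le) (rule count_Suc_mono)

lemma pending_stable:
  assumes "count (pr k (pr n m)) t = count (pr k (pr n m)) t'" "t \<le> t'" "pending (pr k (pr n m)) t \<noteq> 0"
  shows "pending (pr k (pr n m)) t' = pending (pr k (pr n m)) t"
  using assms(2,1)
proof (induction rule: dec_induct)
  case (step t')
  have "count (pr k (pr n m)) t \<le> count (pr k (pr n m)) t'" using step.hyps count_mono by blast
  moreover have "count (pr k (pr n m)) t' \<le> count (pr k (pr n m)) (Suc t')" by (rule count_Suc_mono)
  ultimately have *: "count (pr k (pr n m)) t = count (pr k (pr n m)) t'"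
    "count (pr k (pr n m)) (Suc t') = count (pr k (pr n m)) t'" using step.prems by linarith+
  with step.IH assms(3) show ?case
    by (cases rule: state_Suc_cases[of k n m t']) simp_all
qed simp

text \<open>This makes the level and the number of used witnesses a complete description of the
  element found, whatever the stage at which it is looked up.\<close>

lemma pending_unique:
  assumes "count (pr k (pr n m)) t = count (pr k (pr n m)) t'"
    "pending (pr k (pr n m)) t \<noteq> 0" "pending (pr k (pr n m)) t' \<noteq> 0"
  shows "pending (pr k (pr n m)) t' = pending (pr k (pr n m)) t"
  using pending_stable[of k n m t t'] pending_stable[of k n m t' t] assms
  by (cases "t \<le> t'") auto

lemma snapshot_stable:
  assumes "count (pr k (pr n m)) t = count (pr k (pr n m)) t'" "t \<le> t'"
  shows "snapshot (pr k (pr n m)) t' = snapshot (pr k (pr n m)) t"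
  using assms(2,1)
proof (induction rule: dec_induct)
  case (step t')
  have "count (pr k (pr n m)) t \<le> count (pr k (pr n m)) t'" using step.hyps count_mono by blast
  moreover have "count (pr k (pr n m)) t' \<le> count (pr k (pr n m)) (Suc t')" by (rule count_Suc_mono)
  ultimately have *: "count (pr k (pr n m)) t = count (pr k (pr n m)) t'"
    "count (pr k (pr n m)) (Suc t') = count (pr k (pr n m)) t'" using step.prems by linarith+
  with step.IH show ?case
    by (cases rule: state_Suc_cases[of k n m t']) simp_all
qed simp

text \<open>
  The set \<open>F\<close> collects, for every element found so far, a program covering it that was correct when
  the next witness was put in.  These programs are distinct, since one that was correct at stage \<open>d\<close>
  cannot accept an element that enters \<open>X\<close> after stage \<open>d\<close>.
\<close>

lemma state_invariant:
  fixes k n m t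
  defines "c \<equiv> pr k (pr n m)"
  shows "snapshot c t \<le> t \<and>
    (count c t = 0 \<longrightarrow> pending c t \<noteq> 0) \<and>
    (count c t \<noteq> 0 \<longrightarrow> rejected k n m (count c t - 1) (snapshot c t)) \<and>
    (\<forall>x. count c t \<noteq> 0 \<longrightarrow> pending c t = Suc x \<longrightarrow> x < m \<and> x \<in> X \<and> \<not> enumerated (snapshot c t) x) \<and>
    (\<exists>F. F \<subseteq> {..<2 ^ n - 1} \<and> card F = count c t - 1 \<and> (\<forall>p\<in>F. \<exists>t'\<le>snapshot c t. correct m p t'))"
proof (induction t)
  case 0
  have "\<exists>F. F \<subseteq> {..<(2::nat) ^ n - 1} \<and> card F = 0 \<and> (\<forall>p\<in>F. \<exists>t'\<le>0. correct m p t')"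
    by (intro exI[of _ "{}"]) simp
  then show ?case by simp
next
  case (Suc t)
  show ?case
  proof (cases rule: state_Suc_cases[of k n m t])
    case (found x)
    note found = found[folded c_def]
    then show ?thesis using Suc enumerated_in by auto
  next
    case idle
    note idle = idle[folded c_def]
    then show ?thesis using Suc by auto
  next
    case next_witness
    note next_witness = next_witness[folded c_def]
    from Suc obtain F where F: "F \<subseteq> {..<2 ^ n - 1}" "card F = count c t - 1"
      "\<forall>p\<in>F. \<exists>t'\<le>snapshot c t. correct m p t'" and le: "snapshot c t \<le> t" by blast
    have fin: "finite F" using F(1) finite_subset by blast
    have "\<exists>F. F \<subseteq> {..<2 ^ n - 1} \<and> card F = count c t \<and> (\<forall>p\<in>F. \<exists>t'\<le>t. correct m p t')"
    proof (cases "count c t = 0")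
      case True
      then show ?thesis by (intro exI[of _ "{}"]) simp
    next
      case False
      then obtain x where x: "pending c t = Suc x" "covered n m x t"
        using next_witness by (cases "pending c t") auto
      then have xm: "x < m" "\<not> enumerated (snapshot c t) x"
        using Suc False by auto
      from x(2) obtain p where p: "p < 2 ^ n - 1" "correct m p t"
        "p2 (ev (\<lambda>_. 0) u (pr p x) t) = 3" unfolding covered_def by blast
      have "p \<notin> F"
      proof
        assume "p \<in> F"
        then obtain t' where t': "t' \<le> snapshot c t" "correct m p t'" using F(3) by blast
        have "ev (\<lambda>_. 0) u (pr p x) t = ev (\<lambda>_. 0) u (pr p x) t'"
          using t'(2) p(2) xm(1) ev_halted_unique unfolding correct_def by blast
        then have "enumerated t' x"
          using t'(2) p(3) xm(1) unfolding correct_def by auto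
        then show False using enumerated_mono t'(1) xm(2) by blast
      qed
      then have "card (insert p F) = count c t"
        using F(2) fin False by simp
      moreover have "\<forall>p'\<in>insert p F. \<exists>t'\<le>t. correct m p' t'"
        using F(3) p(2) le order_trans by blast
      ultimately show ?thesis
        using F(1) p(1) by (intro exI[of _ "insert p F"]) auto
    qed
    then show ?thesis using next_witness by simp
  qed
qed

lemmas pending_initial = state_invariant[THEN conjunct2, THEN conjunct1, rule_format]
lemmas rejected_snapshot = state_invariant[THEN conjunct2, THEN conjunct2, THEN conjunct1, rule_format]
lemmas pending_found =
  state_invariant[THEN conjunct2, THEN conjunct2, THEN conjunct2, THEN conjunct1, rule_format]
lemmas covering_programs =
  state_invariant[THEN conjunct2, THEN conjunct2, THEN conjunct2, THEN conjunct2]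

section \<open>The limit of a level\<close>

lemma count_le: "count (pr k (pr n m)) t \<le> 2 ^ n"
proof -
  obtain F :: "nat set" where F: "F \<subseteq> {..<2 ^ n - 1}" "card F = count (pr k (pr n m)) t - 1"
    using covering_programs[where k = k and n = n and m = m and t = t] by (elim exE conjE)
  \<comment> \<open>At most \<open>2 ^ n - 1\<close> covering programs exist, and the first witness
    is put in without one, whence the bound \<open>2 ^ n\<close> for the count.\<close>
  have "card F \<le> 2 ^ n - 1"
    using card_mono[OF finite_lessThan F(1)] unfolding card_lessThan .
  moreover have "(1::nat) \<le> 2 ^ n" by simp
  ultimately show ?thesis using F(2) by linarith
qed

text \<open>The count is monotone and bounded, so it stabilizes at some \<open>i\<close>. If no
  element were pending, \<open>X\<close> below \<open>m\<close> would be unchanged since the last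
  witness was put in, and the reduction would still reject that witness although it is in the set.
  The reduction also rejects witness \<open>i\<close> in the limit, so only a lack of coverage can
  keep the level from moving on.\<close>

lemma eventually_uncovered:
  fixes e g n m
  defines "k \<equiv> pr (code e) g"
  defines "c \<equiv> pr k (pr n m)"
  assumes red: "\<And>i. i \<le> 2 ^ n \<Longrightarrow>
    \<exists>Q. run X e (witness k n i) (if \<exists>t. i < count c t then 1 else 0) Q \<and> (\<forall>q\<in>Q. q < m)"
  shows "\<exists>i x T. i \<noteq> 0 \<and> x \<in> X \<and>
    (\<forall>t\<ge>T. count c t = i \<and> pending c t = Suc x \<and> \<not> covered n m x t)"
proof -
  have "count c t < Suc (2 ^ n)" for t
    using count_le unfolding c_def by (simp add: less_Suc_eq_le)
  then obtain T where "\<forall>t. count c t \<le> count c T"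
    using ex_has_greatest_nat[of "\<lambda>_. True" 0 "count c" "Suc (2 ^ n)"] by auto
  then obtain i where iT: "count c T = i" and i: "\<And>t. count c t \<le> i" by blast
  have T: "count c t = i" if "t \<ge> T" for t
    using count_mono[OF that, of k n m] i[of t] iT unfolding c_def[symmetric] by simp
  have iff: "(\<exists>t. j < count c t) \<longleftrightarrow> j < i" for j
    using i iT less_le_trans by blast
  have "i \<le> 2 ^ n" using iT count_le unfolding c_def by blast
  have rej: "\<exists>T. \<forall>t\<ge>T. rejected k n m i t"
  proof -
    obtain Q where "run X e (witness k n i) 0 Q" "\<forall>q\<in>Q. q < m"
      using red[OF \<open>i \<le> 2 ^ n\<close>] unfolding iff by auto
    from eval_approx_settled[OF this] show ?thesis
      unfolding rejected_def k_def by simp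
  qed
  have "\<exists>t\<ge>T. pending c t \<noteq> 0"
  proof (rule ccontr)
    assume "\<not> (\<exists>t\<ge>T. pending c t \<noteq> 0)"
    then have p0: "pending c t = 0" if "t \<ge> T" for t using that by blast
    then have "i \<noteq> 0" using pending_initial[where k = k and n = n and m = m and t = T] T unfolding c_def by auto
    define d where "d = snapshot c T"
    have d: "snapshot c t = d" if "t \<ge> T" for t
      using snapshot_stable[of k n m T t] T that unfolding d_def c_def by simp
    \<comment> \<open>A new element below \<open>m\<close> would have been found at the next step,
      making \<open>pending\<close> nonzero.\<close>
    have no: "enumerated d x" if "t \<ge> T" "x < m" "enumerated t x" for t x
      using p0[of t] p0[of "Suc t"] d[OF that(1)] that
      by (cases rule: state_Suc_cases[of k n m t, folded c_def]) auto
    have "enumerated d x" if "x \<in> X" "x < m" for x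
    proof -
      obtain t where "enumerated t x" using \<open>x \<in> X\<close> enum enumerated_def by blast
      then have "enumerated (max t T) x" using enumerated_mono by (meson max.cobounded1)
      then show ?thesis using no[of "max t T" x] that by simp
    qed
    then have settled: "\<forall>t\<ge>d. \<forall>x<m. enumerated t x \<longleftrightarrow> x \<in> X"
      using enumerated_in enumerated_mono by blast
    then have same: "approx (pr m t) = approx (pr m d)" if "t \<ge> d" for t
      using approx_settled[of m t] approx_settled[of m d] that by simp
    have "rejected k n m (i - 1) d"
      using rejected_snapshot[where k = k and n = n and m = m and t = T] iT \<open>i \<noteq> 0\<close> unfolding c_def[symmetric] d_def by metis
    then have rd: "ev (approx (pr m d)) (code e) (witness k n (i - 1)) d = pr 0 0"
      unfolding rejected_def k_def by simp
    have "i - 1 < i" "i - 1 \<le> 2 ^ n" using \<open>i \<noteq> 0\<close> \<open>i \<le> 2 ^ n\<close> by simp_all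
    then obtain Q where "run X e (witness k n (i - 1)) 1 Q" "\<forall>q\<in>Q. q < m"
      using red[of "i - 1"] unfolding iff by auto
    from eval_approx_settled[OF this] obtain T' where
      "\<forall>t\<ge>T'. ev (approx (pr m t)) (code e) (witness k n (i - 1)) t = pr 0 1" by blast
    then have "ev (approx (pr m (max d T'))) (code e) (witness k n (i - 1)) (max d T') = pr 0 1"
      by simp
    then have "ev (approx (pr m d)) (code e) (witness k n (i - 1)) (max d T') = pr 0 1"
      using same[of "max d T'"] by simp
    \<comment> \<open>A halted computation keeps its output, but the same oracle gives 0 at stage
      \<open>d\<close> and 1 later.\<close>
    then show False using rd ev_halted_mono[of "approx (pr m d)" "code e" _ d "max d T'"] by simp
  qed
  then obtain T1 x where T1: "T1 \<ge> T" "pending c T1 = Suc x" using not0_implies_Suc by blast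
  have pend: "pending c t = Suc x" if "t \<ge> T1" for t
    using pending_stable[of k n m T1 t] T[of T1] T[of t] T1 that unfolding c_def[symmetric] by simp
  obtain T2 where T2: "\<forall>t\<ge>T2. rejected k n m i t" using rej by blast
  have stuck: "\<not> (i = 0 \<or> covered n m x t)" if "t \<ge> max T1 T2" for t
  proof
    assume "i = 0 \<or> covered n m x t"
    moreover have "count c t = i" "count c (Suc t) = i" "pending c t = Suc x" "rejected k n m i t"
      using that T T1 T2 pend by simp_all
    ultimately show False
      by (cases rule: state_Suc_cases[of k n m t, folded c_def]) auto
  qed
  \<comment> \<open>With \<open>i = 0\<close> no coverage would be required, so the first witness
    would have been put in.\<close>
  from stuck[of "max T1 T2"] have "i \<noteq> 0" by simp
  moreover have "x \<in> X"
    using pending_found[where k = k and n = n and m = m and t = T1 and x = x] T[of T1] T1 \<open>i \<noteq> 0\<close> unfolding c_def[symmetric] by metis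
  ultimately show ?thesis
    using stuck T pend T1 by (intro exI[of _ i] exI[of _ x] exI[of _ "max T1 T2"]) auto
qed

text \<open>Correctness below \<open>m\<close> concerns finitely many inputs: the program halts on
  each of them within some budget, and the enumeration of \<open>X\<close> below \<open>m\<close>
  settles.\<close>

lemma eventually_covered:
  assumes u: "u = code eu"
    and p: "p < 2 ^ n - 1"
    and total: "\<And>z. \<exists>y Q. run {} eu (pr p z) y Q \<and> (y = 3 \<longrightarrow> z \<in> X) \<and> (y = 2 \<longrightarrow> z \<notin> X)"
    and x: "run {} eu (pr p x) 3 Q"
  shows "\<exists>T. \<forall>t\<ge>T. covered n m x t"
proof -
  have "\<exists>T. \<forall>t\<ge>T. \<forall>z<m'. p1 (ev (\<lambda>_. 0) u (pr p z) t) = 0 \<and>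
     (p2 (ev (\<lambda>_. 0) u (pr p z) t) = 3 \<longrightarrow> z \<in> X) \<and>
     (p2 (ev (\<lambda>_. 0) u (pr p z) t) = 2 \<longrightarrow> z \<notin> X)" for m'
  proof (induction m')
    case (Suc m')
    then obtain T where T: "\<forall>t\<ge>T. \<forall>z<m'. p1 (ev (\<lambda>_. 0) u (pr p z) t) = 0 \<and>
     (p2 (ev (\<lambda>_. 0) u (pr p z) t) = 3 \<longrightarrow> z \<in> X) \<and>
     (p2 (ev (\<lambda>_. 0) u (pr p z) t) = 2 \<longrightarrow> z \<notin> X)" by blast
    obtain y R where y: "run {} eu (pr p m') y R" "y = 3 \<longrightarrow> m' \<in> X" "y = 2 \<longrightarrow> m' \<notin> X"
      using total by blast
    from ev_complete[OF y(1), of "\<lambda>_. 0"] obtain T' where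
      "\<forall>t\<ge>T'. ev (\<lambda>_. 0) u (pr p m') t = pr 0 y" unfolding u by auto
    with T y show ?case
      by (intro exI[of _ "max T T'"]) (auto simp: less_Suc_eq)
  qed simp
  then obtain T1 where T1: "\<forall>t\<ge>T1. \<forall>z<m. p1 (ev (\<lambda>_. 0) u (pr p z) t) = 0 \<and>
     (p2 (ev (\<lambda>_. 0) u (pr p z) t) = 3 \<longrightarrow> z \<in> X) \<and>
     (p2 (ev (\<lambda>_. 0) u (pr p z) t) = 2 \<longrightarrow> z \<notin> X)" by blast
  obtain T2 where T2: "\<forall>t\<ge>T2. \<forall>x<m. enumerated t x \<longleftrightarrow> x \<in> X"
    using enumerated_settled by blast
  from ev_complete[OF x, of "\<lambda>_. 0"] obtain T3 where
    T3: "\<forall>t\<ge>T3. ev (\<lambda>_. 0) u (pr p x) t = pr 0 3" unfolding u by auto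
  show ?thesis
    unfolding covered_def correct_def using p T1 T2 T3
    by (intro exI[of _ "max T1 (max T2 T3)"]) auto
qed


text \<open>Combines the two sides of the comparison: at every level \<open>n\<close> the stuck
  element is never covered, and a single partial recursive \<open>f\<close> computes it from a
  number that codes a string of length \<open>n\<close>.\<close>

lemma hard_elements:
  fixes e gm g
  defines "k \<equiv> pr (code e) (code gm)"
  assumes gm: "\<And>x. \<exists>Q. run {} gm x (g x) Q"
    and red: "\<And>x. \<exists>Q. run X e x (if x \<in> diag_set then 1 else 0) Q \<and> (\<forall>q\<in>Q. q < g x)"
  shows "\<exists>f. partial_recursive f \<and> (\<forall>n. \<exists>x\<in>X. \<exists>p. 2 ^ n \<le> Suc p \<and> Suc p < 2 ^ Suc n \<and>
    (\<forall>z. f (pr p z) = Some (Suc x)) \<and> (\<exists>m T. \<forall>t\<ge>T. \<not> covered n m x t))"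
proof -
  \<comment> \<open>Here \<open>x\<close> packs a program \<open>p\<close> with its input, and
    \<open>w\<close> a level with a stage. The inequalities recover the level as the length of the
    string numbered \<open>p\<close>; the offset of \<open>Suc p\<close> from \<open>2 ^ n\<close>
    is the count minus one.\<close>
  define R where "R = (\<lambda>x w. 2 ^ p1 w \<le> Suc (p1 x) \<and> Suc (p1 x) < 2 ^ Suc (p1 w) \<and>
    bound_halts k (p1 w) (p2 w) \<and> p1 (level k (p1 w) (p2 w)) = Suc (Suc (p1 x) - 2 ^ p1 w) \<and>
    \<not> p2 (p2 (level k (p1 w) (p2 w))) = 0)"
  \<comment> \<open>The stored successor agrees with the coding of outcomes, where 0 is reserved for
    \<open>Bot\<close>.\<close>
  define h where "h = (\<lambda>(x::nat) w. p2 (p2 (level k (p1 w) (p2 w))))"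
  define f where "f = (\<lambda>x. if \<exists>w. R x w then Some (h x (LEAST w. R x w)) else None)"
  define m where "m = (\<lambda>n. \<Sum>j<Suc (2 ^ n). g (witness k n j))"
  have f: "partial_recursive f"
    unfolding f_def
  proof (rule partial_recursive_search)
    show "recp (\<lambda>w. R (p1 w) (p2 w))"
      unfolding R_def by (intro rec_intros recp_bound_halts recf_level)
    show "recf (\<lambda>w. h (p1 w) (p2 w))"
      unfolding h_def by (intro rec_intros recf_level)
  qed
  have "\<exists>T. \<forall>t\<ge>T. ev (\<lambda>_. 0) (code gm) x t = pr 0 (g x)" for x
    using gm[of x] ev_complete[of "{}" gm x "g x" _ "\<lambda>_. 0"] by auto
  then obtain T where T: "\<And>x t. t \<ge> T x \<Longrightarrow> ev (\<lambda>_. 0) (code gm) x t = pr 0 (g x)"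
    by metis
  have val: "p2 (ev (\<lambda>_. 0) (code gm) x t) = g x" if "p1 (ev (\<lambda>_. 0) (code gm) x t) = 0" for x t
  proof -
    have Tx: "ev (\<lambda>_. 0) (code gm) x (T x) = pr 0 (g x)" by (rule T) simp
    show ?thesis using ev_halted_unique[OF _ that, of "T x"] unfolding Tx by simp
  qed
  have bound: "bound k n t = m n" if "bound_halts k n t" for n t
    using that val unfolding bound_halts_def bound_def m_def k_def by (intro sum.cong) auto
  have halts: "\<exists>T'. \<forall>t\<ge>T'. bound_halts k n t" for n
  proof (intro exI allI impI)
    fix t assume t: "(\<Sum>j<Suc (2 ^ n). T (witness k n j)) \<le> t"
    have "T (witness k n j) \<le> t" if "j < Suc (2 ^ n)" for j
      using member_le_sum[of j "{..<Suc (2 ^ n)}" "\<lambda>j. T (witness k n j)"] that t by simp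
    then show "bound_halts k n t"
      unfolding bound_halts_def using T by (simp add: k_def)
  qed
  have level: "level k n t = state (pr k (pr n (m n))) t" if "bound_halts k n t" for n t
    using bound[OF that] by (simp add: level_def)
  \<comment> \<open>Stages before the use bounds have halted do not matter: the count never
    decreases, so a later stage also shows membership.\<close>
  have diag: "witness k n i \<in> diag_set \<longleftrightarrow> (\<exists>t. i < count (pr k (pr n (m n))) t)" for n i
  proof
    assume "witness k n i \<in> diag_set"
    then show "\<exists>t. i < count (pr k (pr n (m n))) t"
      using level unfolding diag_set_def witness_def count_def by auto
  next
    assume "\<exists>t. i < count (pr k (pr n (m n))) t"
    then obtain t where t: "i < count (pr k (pr n (m n))) t" by blast
    obtain T' where T': "\<forall>t\<ge>T'. bound_halts k n t" using halts by blast
    have "i < count (pr k (pr n (m n))) (max t T')"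
      using t count_mono[of t "max t T'" k n "m n"] by simp
    then show "witness k n i \<in> diag_set"
      using T' level[of n "max t T'"] unfolding diag_set_def witness_def count_def
      by (auto intro!: exI[of _ "max t T'"])
  qed
  have "\<exists>x\<in>X. \<exists>p. 2 ^ n \<le> Suc p \<and> Suc p < 2 ^ Suc n \<and>
    (\<forall>z. f (pr p z) = Some (Suc x)) \<and> (\<exists>m T. \<forall>t\<ge>T. \<not> covered n m x t)" for n
  proof -
    let ?c = "pr k (pr n (m n))"
    have "\<exists>Q. run X e (witness k n i) (if \<exists>t. i < count ?c t then 1 else 0) Q \<and> (\<forall>q\<in>Q. q < m n)"
      if "i \<le> 2 ^ n" for i
    proof -
      have "g (witness k n i) \<le> m n"
        unfolding m_def
        using member_le_sum[of i "{..<Suc (2 ^ n)}" "\<lambda>j. g (witness k n j)"] that by simp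
      then show ?thesis
        using red[of "witness k n i"] unfolding diag by (meson less_le_trans)
    qed
    from eventually_uncovered[of n e "code gm" "m n", folded k_def, OF this]
    obtain i x T1 where x: "i \<noteq> 0" "x \<in> X"
      "\<forall>t\<ge>T1. count ?c t = i \<and> pending ?c t = Suc x \<and> \<not> covered n (m n) x t" by blast
    obtain T2 where T2: "\<forall>t\<ge>T2. bound_halts k n t" using halts by blast
    define t where "t = max T1 T2"
    have t: "count ?c t = i" "pending ?c t = Suc x" "bound_halts k n t"
      using x T2 unfolding t_def by auto
    \<comment> \<open>The count satisfies \<open>1 \<le> i\<close> and \<open>i \<le> 2 ^ n\<close>,
      which matches the \<open>2 ^ n\<close> strings of length \<open>n\<close>.\<close>
    define p where "p = 2 ^ n + i - 2"
    have "i \<le> 2 ^ n" using count_le t(1) by blast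
    moreover have "(1::nat) \<le> 2 ^ n" by simp
    ultimately have p: "Suc (Suc p) = 2 ^ n + i" "2 ^ n \<le> Suc p" "Suc p < 2 ^ Suc n"
      using x(1) unfolding p_def power_Suc by linarith+
    have search: "\<exists>w. R (pr p z) w" for z
      using p t level[OF t(3)] unfolding R_def count_def pending_def
      by (intro exI[of _ "pr n t"]) simp
    \<comment> \<open>The search may succeed at a stage other than \<open>t\<close>; the level is
      forced by \<open>p\<close>, and \<open>pending_unique\<close> then gives the same
      element.\<close>
    have unique: "h (pr p z) w = Suc x" if w: "R (pr p z) w" for z w
    proof -
      define t' where "t' = p2 w"
      have bounds: "2 ^ p1 w \<le> Suc p" "Suc p < 2 ^ Suc (p1 w)" using w unfolding R_def by simp_all
      have "(2::nat) ^ n < 2 ^ Suc (p1 w)" "(2::nat) ^ p1 w < 2 ^ Suc n"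
        using p bounds by linarith+
      then have "n < Suc (p1 w)" "p1 w < Suc n"
        by (metis one_less_numeral_iff power_strict_increasing_iff semiring_norm(76))+
      then have "p1 w = n" by simp
      then have h': "bound_halts k n t'" "p1 (level k n t') = Suc (Suc p - 2 ^ n)"
        "p2 (p2 (level k n t')) \<noteq> 0"
        using w unfolding R_def t'_def by simp_all
      then have "count ?c t' = i" "pending ?c t' \<noteq> 0"
        using level[OF h'(1)] p(1,2) unfolding count_def pending_def by simp_all
      then have "pending ?c t' = Suc x"
        using pending_unique[of k n "m n" t t'] t by simp
      then show ?thesis
        using level[OF h'(1)] \<open>p1 w = n\<close> unfolding h_def pending_def t'_def by simp
    qed
    have "f (pr p z) = Some (Suc x)" for z
      unfolding f_def using search[of z] unique[of z, OF LeastI_ex[OF search[of z]]] by simp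
    moreover have "\<exists>m T. \<forall>t\<ge>T. \<not> covered n m x t" using x(3) by blast
    ultimately show ?thesis using p(2,3) x(2) by blast
  qed
  with f show ?thesis by blast
qed

end

section \<open>Strings, outcomes and the optimal machine\<close>

lemma length_less_iff: "length p < n \<longleftrightarrow> str_nat p < 2 ^ n - 1"
proof
  assume "length p < n"
  then have "2 * 2 ^ length p \<le> (2::nat) ^ n"
    using power_increasing[of "Suc (length p)" n "2::nat"] by simp
  then show "str_nat p < 2 ^ n - 1" using str_nat_bounds[of p] by linarith
next
  assume "str_nat p < 2 ^ n - 1"
  then have "(2::nat) ^ length p < 2 ^ n" using str_nat_bounds[of p] by linarith
  then show "length p < n" by simp
qed

lemma length_inv_str_nat:
  assumes "2 ^ n \<le> Suc p" "Suc p < 2 ^ Suc n"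
  shows "length (inv str_nat p) = n"
proof -
  have "str_nat (inv str_nat p) = p" using bij_str_nat by (simp add: bij_is_surj surj_f_inv_f)
  then show ?thesis
    using assms length_less_iff[of "inv str_nat p" n] length_less_iff[of "inv str_nat p" "Suc n"]
    by auto
qed

definition nat_outcome :: "nat \<Rightarrow> outcome" where
  "nat_outcome y = (case y of 0 \<Rightarrow> Bot | Suc w \<Rightarrow> Str (inv str_nat w))"

lemma outcome_nat_outcome: "outcome_nat (nat_outcome y) = y"
  using bij_str_nat by (cases y) (simp_all add: nat_outcome_def bij_is_surj surj_f_inv_f)

lemma partial_recursive_mapping_nat_outcome:
  assumes "partial_recursive f"
  shows "partial_recursive_mapping
    (\<lambda>p z. map_option nat_outcome (f (prod_encode (str_nat p, str_nat z))))"
  unfolding partial_recursive_mapping_def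
  by (rule exI[of _ f]) (simp add: assms option.map_comp o_def outcome_nat_outcome option.map_ident)

lemma partial_recursive_total: "recf f \<Longrightarrow> partial_recursive (\<lambda>x. Some (f x))"
  unfolding recf_def partial_recursive_def using run_deterministic by (metis option.inject)

lemma inst_complexity_finite:
  assumes "optimal U" "x \<in> A"
  shows "inst_complexity U x A < \<infinity>"
proof -
  define f where "f = (\<lambda>w. Some (if p1 w = p2 w then 3 else 0 :: nat))"
  define V where "V = (\<lambda>p z. map_option nat_outcome (f (prod_encode (str_nat p, str_nat z))))"
  have "partial_recursive f"
    unfolding f_def by (intro partial_recursive_total rec_intros)
  then have "partial_recursive_mapping V"
    unfolding V_def by (rule partial_recursive_mapping_nat_outcome)
  then obtain d where d: "inst_complexity U x A \<le> inst_complexity V x A + enat d"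
    using assms(1) unfolding optimal_def by blast
  have "inv str_nat (str_nat [True]) = [True]"
    using bij_str_nat by (simp only: bij_is_inj inv_f_f)
  then have 3: "nat_outcome 3 = Str [True]"
    by (simp add: nat_outcome_def numeral_3_eq_3 numeral_2_eq_2)
  have 0: "nat_outcome 0 = Bot" by (simp add: nat_outcome_def)
  have V: "V p z = Some (if p = z then Str [True] else Bot)" for p z
    using bij_str_nat unfolding V_def f_def pr_def[symmetric]
    by (auto simp: 0 3 bij_is_inj inj_eq)
  have "inst_complexity V x A \<le> enat (length x)"
    unfolding inst_complexity_def
    by (rule Inf_lower) (use assms(2) in \<open>auto simp: V consistent_def char_fun_def\<close>)
  then have "inst_complexity V x A + enat d \<le> enat (length x + d)"
    by (metis add_right_mono plus_enat_simps(1))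
  with d have "inst_complexity U x A \<le> enat (length x + d)" by (rule order_trans)
  then show ?thesis by (cases "inst_complexity U x A") auto
qed

theorem theorem4p3:
  fixes U :: "bool list \<Rightarrow> bool list \<Rightarrow> outcome option"
    and A :: "bool list set"
  assumes "optimal U"
    and "wtt_complete (str_nat ` A)"
  shows "\<exists>c::nat. infinite {x \<in> A. kolmogorov U x \<le> inst_complexity U x A + enat c}"
proof -
  obtain fU eU where U: "oracle_free eU" "\<And>x y. fU x = Some y \<longleftrightarrow> (\<exists>Q. run {} eU x y Q)"
    "\<And>p z. fU (prod_encode (str_nat p, str_nat z)) = map_option outcome_nat (U p z)"
    using assms(1) unfolding optimal_def partial_recursive_mapping_def partial_recursive_def by blast
  obtain fA eA where A: "str_nat ` A = dom fA" "\<And>x y. fA x = Some y \<longleftrightarrow> (\<exists>Q. run {} eA x y Q)"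
    using assms(2) unfolding wtt_complete_def re_set_def partial_recursive_def by blast
  interpret construction "code eA" "code eU" "str_nat ` A"
  proof
    fix x
    show "x \<in> str_nat ` A \<longleftrightarrow> (\<exists>t. p1 (ev (\<lambda>_. 0) (code eA) x t) = 0)"
    proof
      assume "x \<in> str_nat ` A"
      then obtain y Q where "run {} eA x y Q" using A by auto
      from ev_complete[OF this, of "\<lambda>_. 0"] obtain t where "ev (\<lambda>_. 0) (code eA) x t = pr 0 y"
        by auto
      then show "\<exists>t. p1 (ev (\<lambda>_. 0) (code eA) x t) = 0"
        by (intro exI[of _ t]) simp
    next
      assume "\<exists>t. p1 (ev (\<lambda>_. 0) (code eA) x t) = 0"
      then show "x \<in> str_nat ` A" using ev_sound A by blast
    qed
  qed
  have "wtt_reducible diag_set (str_nat ` A)"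
    using assms(2) re_set_diag_set unfolding wtt_complete_def by blast
  then obtain e g where g: "total_recursive g" and
    e: "\<And>x. \<exists>Q. run (str_nat ` A) e x (if x \<in> diag_set then 1 else 0) Q \<and> (\<forall>q\<in>Q. q < g x)"
    unfolding wtt_reducible_def by blast
  obtain gm where gm: "\<And>x. \<exists>Q. run {} gm x (g x) Q"
    using g unfolding total_recursive_def partial_recursive_def by blast
  obtain f where f: "partial_recursive f" and
    hard: "\<And>n. \<exists>x\<in>str_nat ` A. \<exists>p. 2 ^ n \<le> Suc p \<and> Suc p < 2 ^ Suc n \<and>
      (\<forall>z. f (pr p z) = Some (Suc x)) \<and> (\<exists>m T. \<forall>t\<ge>T. \<not> covered n m x t)"
    using hard_elements[OF gm e] by blast
  define V where "V = (\<lambda>p z. map_option nat_outcome (f (prod_encode (str_nat p, str_nat z))))"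
  have "partial_recursive_mapping V"
    unfolding V_def using f by (rule partial_recursive_mapping_nat_outcome)
  then obtain d where d: "\<And>x. kolmogorov U x \<le> kolmogorov V x + enat d"
    using assms(1) unfolding optimal_def by blast
  have inv_str: "inv str_nat (str_nat x) = x" and str_inv: "str_nat (inv str_nat y) = y" for x y
    using bij_str_nat by (simp_all add: bij_is_inj bij_is_surj surj_f_inv_f)
  have ex: "\<exists>x\<in>A. enat n \<le> inst_complexity U x A \<and> kolmogorov U x \<le> inst_complexity U x A + enat d" for n
  proof -
    obtain x p m T where x: "x \<in> A" and p: "2 ^ n \<le> Suc p" "Suc p < 2 ^ Suc n"
      "\<And>z. f (pr p z) = Some (Suc (str_nat x))" and unc: "\<forall>t\<ge>T. \<not> covered n m (str_nat x) t"
      using hard[of n] by auto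
    have "V (inv str_nat p) [] = Some (Str x)"
      unfolding V_def str_inv pr_def[symmetric] p(3) by (simp add: nat_outcome_def inv_str)
    then have "kolmogorov V x \<le> enat (length (inv str_nat p))"
      unfolding kolmogorov_def by (intro Inf_lower) auto
    also have "length (inv str_nat p) = n" by (rule length_inv_str_nat) fact+
    finally have "kolmogorov U x \<le> enat n + enat d"
      using d[of x] add_right_mono order_trans by blast
    moreover have "enat n \<le> inst_complexity U x A"
      unfolding inst_complexity_def
    proof (rule Inf_greatest)
      fix l
      assume "l \<in> {enat (length p) | p. dom (U p) = UNIV \<and> consistent A (U p) \<and>
        U p x = Some (char_fun A x)}"
      then obtain q where q: "l = enat (length q)" "dom (U q) = UNIV" "consistent A (U q)"
        "U q x = Some (char_fun A x)" by blast
      \<comment> \<open>A shorter program witnessing the instance complexity would eventually cover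
        \<open>x\<close>, contrary to the choice of \<open>x\<close>.\<close>
      have "\<not> length q < n"
      proof
        assume "length q < n"
        then have "str_nat q < 2 ^ n - 1" by (simp add: length_less_iff)
        moreover have "\<exists>y Q. run {} eU (pr (str_nat q) z) y Q \<and> (y = 3 \<longrightarrow> z \<in> str_nat ` A) \<and>
          (y = 2 \<longrightarrow> z \<notin> str_nat ` A)" for z
        proof -
          obtain o' where o: "U q (inv str_nat z) = Some o'" using q(2) by blast
          then have "fU (pr (str_nat q) z) = Some (outcome_nat o')"
            using U(3)[of q "inv str_nat z"] by (simp add: str_inv pr_def)
          then obtain Q where "run {} eU (pr (str_nat q) z) (outcome_nat o') Q" using U(2) by blast
          moreover have "o' = char_fun A (inv str_nat z) \<or> o' = Bot"
            using q(3) o unfolding consistent_def by (metis domI option.inject)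
          moreover have "z \<in> str_nat ` A \<longleftrightarrow> inv str_nat z \<in> A"
            by (metis image_iff inv_str str_inv)
          ultimately show ?thesis by (auto simp: char_fun_def)
        qed
        moreover have "\<exists>Q. run {} eU (pr (str_nat q) (str_nat x)) 3 Q"
          using U(2)[of "pr (str_nat q) (str_nat x)" 3] U(3)[of q x] q(4) x
          by (simp add: pr_def char_fun_def)
        ultimately have "\<exists>T. \<forall>t\<ge>T. covered n m (str_nat x) t"
          using eventually_covered[of eU "str_nat q" n "str_nat x"] by blast
        then show False using unc by (meson nle_le)
      qed
      then show "enat n \<le> l" using q(1) by simp
    qed
    ultimately show ?thesis
      using x by (meson add_right_mono order_trans)
  qed
  have "infinite {x \<in> A. kolmogorov U x \<le> inst_complexity U x A + enat d}" (is "infinite ?H")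
  proof
    assume fin: "finite ?H"
    have "\<exists>N. inst_complexity U x A = enat N" if "x \<in> A" for x
      using inst_complexity_finite[OF assms(1) that] by auto
    then obtain N where N: "\<And>x. x \<in> A \<Longrightarrow> inst_complexity U x A = enat (N x)" by metis
    \<comment> \<open>The threshold exceeds the instance complexity of every member of the
      supposedly finite set, yet \<open>x\<close> belongs to that set.\<close>
    obtain x where x: "x \<in> A" "enat (Suc (\<Sum>x\<in>?H. N x)) \<le> inst_complexity U x A"
      "kolmogorov U x \<le> inst_complexity U x A + enat d"
      using ex by blast
    then have "N x \<le> (\<Sum>x\<in>?H. N x)"
      using fin by (intro member_le_sum) auto
    then show False using x N by simp
  qed
  then show ?thesis by blast
qed

end
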